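(* Let $(V,\omega)$ be a symplectic vector space of (even) dimension $n\ge2$ and let $\mathcal F_\omega(V)=\rho(\Gamma(\mathfrak{sp}(V,\omega)))\subseteq\mathfrak X(V)$ be the singular foliation generated by the linear action of $\mathfrak{sp}(V,\omega)$. For $i=3,\dots,n+1$ let $C_i:=\mathrm{coker}(\phi_i^\omega)$, where $\phi^\omega_i:\wedge^iV^*\otimes V\to\wedge^{i-1}V^*\otimes\wedge^2V^*$ is $\phi_i^\omega(\alpha\otimes X)=(-1)^{i-1}\iota_{e_j}(\alpha)\otimes e^j\wedge\iota_X\omega$ (and $\phi^\omega_{n+1}:0\to\wedge^nV^*\otimes\wedge^2V^*$ is the zero map). Then the sequence $$0\to\Gamma(C_{n+1})\xrightarrow{\bar\partial_n}\Gamma(C_n)\xrightarrow{\bar\partial_{n-1}}\cdots\xrightarrow{\bar\partial_3}\Gamma(C_3)\xrightarrow{\,d_2(\phi_2^\omega)^{-1}\partial_2\,}\Gamma(\mathfrak{sp}(V,\omega))\xrightarrow{\ \rho\ }\mathcal F_\omega(V)\to0$$ is exact.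
   Context: $\Gamma(U)=C^\infty(V,U)$ for a finite-dimensional vector space $U$; $\{e_i\},\{e^i\}$ are dual bases of $V,V^*$, $x^i$ the linear coordinates, repeated indices are summed. $\mathfrak{sp}(V,\omega)=\{A\in\mathfrak{gl}(V)\mid\omega(Ax,y)+\omega(x,Ay)=0\ \forall x,y\}$. $\rho(\phi\otimes v)=\phi\,\partial_v$ on $\Gamma(V^*\otimes V)$, with $\phi$ viewed as a linear function. $d_p(\alpha\otimes v)=x^i\iota_{e_i}(\alpha)\otimes v$ on $\Gamma(\wedge^pV^*\otimes V)$, and $\partial_p(\alpha\otimes\tau)=-x^i\iota_{e_i}(\alpha)\otimes\tau$ maps $\Gamma(\wedge^pV^*\otimes\wedge^2V^* )$ to $\Gamma(\wedge^{p-1}V^*\otimes\wedge^2V^* )$. One has $\phi^\omega_pd_{p+1}+\partial_p\phi^\omega_{p+1}=0$, so $\partial_p$ induces $\bar\partial_p:\Gamma(C_{p+1})\to\Gamma(C_p)$; $\phi_2^\omega$ is an isomorphism, and $d_2(\phi_2^\omega)^{-1}\partial_2$ denotes the map induced on $\Gamma(C_3)$, $C_3$ being a quotient of $\wedge^2V^*\otimes\wedge^2V^*$. All linear maps are extended $C^\infty(V)$-linearly. *)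

theory Defs
  imports "HOL-Analysis.Analysis" "HOL-Library.Function_Algebras" "HOL-Library.Set_Algebras"
begin

text \<open>
  A finite-dimensional real vector space \<open>V\<close> is a type of class \<open>euclidean_space\<close>. Its inner
  product serves only to name dual bases \<open>e_i\<close> (the set \<open>Basis\<close>) and \<open>e^i = (\<lambda>x. x \<bullet> e_i)\<close>;
  accordingly \<open>x^i\<close> at the point \<open>q\<close> is \<open>q \<bullet> e_i\<close>.
  Forms, endomorphisms and sections are functions, with pointwise vector space structure.
\<close>

instantiation "fun" :: (type, real_vector) real_vector
begin

definition scaleR_fun :: "real \<Rightarrow> ('a \<Rightarrow> 'b) \<Rightarrow> 'a \<Rightarrow> 'b"
  where "scaleR_fun c f = (\<lambda>x. c *\<^sub>R f x)"

instance
  by standard (auto simp: scaleR_fun_def fun_eq_iff plus_fun_def algebra_simps)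

end

lemma scaleR_fun_apply [simp]: "(c *\<^sub>R f) x = c *\<^sub>R f x"
  by (simp add: scaleR_fun_def)

lemma sum_fun_apply: "(\<Sum>i\<in>A. f i) x = (\<Sum>i\<in>A. f i x)"
  by (induction A rule: infinite_finite_induct) (auto simp: zero_fun_def plus_fun_def)


section \<open>Smooth maps\<close>

primrec k_times_differentiable :: "nat \<Rightarrow> ('v::euclidean_space \<Rightarrow> real) \<Rightarrow> bool" where
  "k_times_differentiable 0 f \<longleftrightarrow> continuous_on UNIV f"
| "k_times_differentiable (Suc k) f \<longleftrightarrow> (\<forall>x. f differentiable (at x)) \<and>
     (\<forall>v. k_times_differentiable k (\<lambda>x. frechet_derivative f (at x) v))"

definition smooth :: "('v::euclidean_space \<Rightarrow> real) \<Rightarrow> bool"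
  where "smooth f \<longleftrightarrow> (\<forall>k. k_times_differentiable k f)"

text \<open>
  \<open>\<Gamma>(U) = C\<^sup>\<infinity>(V,U)\<close> for a finite-dimensional linear subspace \<open>U\<close> of any real vector space: a map
  into \<open>U\<close> is smooth if its composition with every linear functional is. Every functional on \<open>U\<close>
  extends to the ambient space, so \<open>\<l>\<close> may range over functionals on the latter.
\<close>

definition sections :: "'u::real_vector set \<Rightarrow> ('v::euclidean_space \<Rightarrow> 'u) set"
  where "sections U =
    {f. (\<forall>q. f q \<in> U) \<and> (\<forall>\<l>. linear \<l> \<longrightarrow> smooth (\<lambda>q. \<l> (f q)))}"

text \<open>
  The quotient \<open>U/N\<close> consists of the cosets \<open>u +o N\<close>. The linear functionals on \<open>U/N\<close> are those on
  \<open>U\<close> that vanish on \<open>N\<close>; such a functional is constant on each coset, and \<open>the_elem (\<l> ` c)\<close> is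
  its value on the coset \<open>c\<close>.
\<close>

definition quotient_space :: "'u::real_vector set \<Rightarrow> 'u set \<Rightarrow> 'u set set"
  where "quotient_space U N = (\<lambda>u. u +o N) ` U"

definition quotient_sections ::
    "'u::real_vector set \<Rightarrow> 'u set \<Rightarrow> ('v::euclidean_space \<Rightarrow> 'u set) set"
  where "quotient_sections U N =
    {F. (\<forall>q. F q \<in> quotient_space U N) \<and>
        (\<forall>\<l>. linear \<l> \<and> (\<forall>u\<in>N. \<l> u = 0) \<longrightarrow> smooth (\<lambda>q. the_elem (\<l> ` F q)))}"


section \<open>Vector-valued exterior forms\<close>

text \<open>
  \<open>\<And>\<^sup>pV\<^sup>* \<otimes> U\<close> is the space of alternating \<open>p\<close>-linear maps \<open>V\<^sup>p \<rightarrow> U\<close>, given as functions on lists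
  that vanish on lists of length other than \<open>p\<close>. The lemmas below show that the decomposable
  elements \<open>\<alpha> \<otimes> u\<close> span it and compute the operators on them.
\<close>

definition forms :: "nat \<Rightarrow> 'u::real_vector set \<Rightarrow> ('v::euclidean_space list \<Rightarrow> 'u) set"
  where "forms p U =
    {\<eta>. (\<forall>xs. \<eta> xs \<in> U) \<and>
        (\<forall>xs. length xs \<noteq> p \<longrightarrow> \<eta> xs = 0) \<and>
        (\<forall>xs i. length xs = p \<and> i < p \<longrightarrow> linear (\<lambda>v. \<eta> (xs[i := v]))) \<and>
        (\<forall>xs. length xs = p \<and> \<not> distinct xs \<longrightarrow> \<eta> xs = 0)}"

definition tensor :: "('v list \<Rightarrow> real) \<Rightarrow> 'u::real_vector \<Rightarrow> 'v list \<Rightarrow> 'u" (infixr \<open>\<otimes>\<^sub>f\<close> 75)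
  where "\<alpha> \<otimes>\<^sub>f u = (\<lambda>xs. \<alpha> xs *\<^sub>R u)"

definition contract :: "'v \<Rightarrow> ('v list \<Rightarrow> 'u) \<Rightarrow> 'v list \<Rightarrow> 'u"
  where "contract v \<alpha> = (\<lambda>xs. \<alpha> (v # xs))"

definition two_forms :: "('v::euclidean_space \<Rightarrow> 'v \<Rightarrow> real) set"
  where "two_forms = {B. bilinear B \<and> (\<forall>x. B x x = 0)}"

definition wedge :: "('v \<Rightarrow> real) \<Rightarrow> ('v \<Rightarrow> real) \<Rightarrow> 'v \<Rightarrow> 'v \<Rightarrow> real"
  where "wedge \<alpha> \<beta> = (\<lambda>x y. \<alpha> x * \<beta> y - \<alpha> y * \<beta> x)"

definition symplectic_form :: "('v::euclidean_space \<Rightarrow> 'v \<Rightarrow> real) \<Rightarrow> bool"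
  where "symplectic_form \<omega> \<longleftrightarrow> \<omega> \<in> two_forms \<and> (\<forall>x. (\<forall>y. \<omega> x y = 0) \<longrightarrow> x = 0)"


section \<open>The operators\<close>

text \<open>
  \<open>d_p\<close>, \<open>\<partial>_p\<close> and \<open>\<phi>\<^sup>\<omega>_i\<close> are linear over \<open>C\<^sup>\<infinity>(V)\<close>, so they are given by their action on the fibre
  over the point \<open>q\<close>. On forms, \<open>\<iota>_X \<omega>\<close> is the covector \<open>\<omega> X\<close>.
\<close>

definition d :: "'v::euclidean_space \<Rightarrow> ('v list \<Rightarrow> 'v) \<Rightarrow> 'v list \<Rightarrow> 'v"
  where "d q \<eta> = (\<Sum>e\<in>Basis. (q \<bullet> e) *\<^sub>R contract e \<eta>)"

definition del :: "'v::euclidean_space \<Rightarrow> ('v list \<Rightarrow> 'v \<Rightarrow> 'v \<Rightarrow> real) \<Rightarrow> 'v list \<Rightarrow> 'v \<Rightarrow> 'v \<Rightarrow> real"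
  where "del q \<eta> = - (\<Sum>e\<in>Basis. (q \<bullet> e) *\<^sub>R contract e \<eta>)"

definition phi ::
    "('v::euclidean_space \<Rightarrow> 'v \<Rightarrow> real) \<Rightarrow> nat \<Rightarrow> ('v list \<Rightarrow> 'v) \<Rightarrow> 'v list \<Rightarrow> 'v \<Rightarrow> 'v \<Rightarrow> real"
  where "phi \<omega> i \<eta> =
    (-1) ^ (i - 1) *\<^sub>R (\<Sum>e\<in>Basis. (\<lambda>xs. wedge (\<lambda>x. x \<bullet> e) (\<omega> (contract e \<eta> xs))))"

text \<open>
  For \<open>i = n + 1\<close> the space \<open>forms i UNIV\<close> is zero, so that \<open>\<phi>\<^sup>\<omega>_(n+1)\<close> is the zero map on the zero
  space, without a separate clause.
\<close>

definition im_phi :: "('v::euclidean_space \<Rightarrow> 'v \<Rightarrow> real) \<Rightarrow> nat \<Rightarrow> ('v list \<Rightarrow> 'v \<Rightarrow> 'v \<Rightarrow> real) set"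
  where "im_phi \<omega> i = phi \<omega> i ` forms i UNIV"

definition \<Gamma>C ::
    "('v::euclidean_space \<Rightarrow> 'v \<Rightarrow> real) \<Rightarrow> nat \<Rightarrow> ('v \<Rightarrow> ('v list \<Rightarrow> 'v \<Rightarrow> 'v \<Rightarrow> real) set) set"
  where "\<Gamma>C \<omega> i = quotient_sections (forms (i - 1) two_forms) (im_phi \<omega> i)"

definition zeroC ::
    "('v::euclidean_space \<Rightarrow> 'v \<Rightarrow> real) \<Rightarrow> nat \<Rightarrow> 'v \<Rightarrow> ('v list \<Rightarrow> 'v \<Rightarrow> 'v \<Rightarrow> real) set"
  where "zeroC \<omega> i = (\<lambda>q. im_phi \<omega> i)"

text \<open>The maps induced on cosets: \<open>the_elem\<close> extracts the common value on all representatives.\<close>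

definition del_bar ::
    "('v::euclidean_space \<Rightarrow> 'v \<Rightarrow> real) \<Rightarrow> nat \<Rightarrow> ('v \<Rightarrow> ('v list \<Rightarrow> 'v \<Rightarrow> 'v \<Rightarrow> real) set) \<Rightarrow>
       'v \<Rightarrow> ('v list \<Rightarrow> 'v \<Rightarrow> 'v \<Rightarrow> real) set"
  where "del_bar \<omega> p F = (\<lambda>q. the_elem ((\<lambda>\<eta>. del q \<eta> +o im_phi \<omega> p) ` F q))"

definition phi2_inv ::
    "('v::euclidean_space \<Rightarrow> 'v \<Rightarrow> real) \<Rightarrow> ('v list \<Rightarrow> 'v \<Rightarrow> 'v \<Rightarrow> real) \<Rightarrow> 'v list \<Rightarrow> 'v"
  where "phi2_inv \<omega> = inv_into (forms 2 UNIV) (phi \<omega> 2)"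

text \<open>
  \<open>\<eta> \<in> V\<^sup>* \<otimes> V\<close>, a \<open>V\<close>-valued 1-form, is identified with the endomorphism \<open>x \<mapsto> \<eta> [x]\<close>. Under the
  same identification \<open>\<phi> \<otimes> v\<close> is \<open>x \<mapsto> \<phi>(x) v\<close>, and the vector field \<open>\<phi> \<partial>_v\<close>, viewed as a map
  \<open>V \<rightarrow> V\<close>, is \<open>q \<mapsto> \<phi>(q) v\<close>; hence the formula for \<open>\<rho>\<close>.
\<close>

definition connecting ::
    "('v::euclidean_space \<Rightarrow> 'v \<Rightarrow> real) \<Rightarrow> ('v \<Rightarrow> ('v list \<Rightarrow> 'v \<Rightarrow> 'v \<Rightarrow> real) set) \<Rightarrow>
       'v \<Rightarrow> 'v \<Rightarrow> 'v"
  where "connecting \<omega> F =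
    (\<lambda>q. the_elem ((\<lambda>\<eta>. (\<lambda>x. d q (phi2_inv \<omega> (del q \<eta>)) [x])) ` F q))"

definition sp :: "('v::euclidean_space \<Rightarrow> 'v \<Rightarrow> real) \<Rightarrow> ('v \<Rightarrow> 'v) set"
  where "sp \<omega> = {A. linear A \<and> (\<forall>x y. \<omega> (A x) y + \<omega> x (A y) = 0)}"

definition rho :: "('v \<Rightarrow> 'v \<Rightarrow> 'v) \<Rightarrow> 'v \<Rightarrow> 'v"
  where "rho A = (\<lambda>q. A q q)"

definition foliation :: "('v::euclidean_space \<Rightarrow> 'v \<Rightarrow> real) \<Rightarrow> ('v \<Rightarrow> 'v) set"
  where "foliation \<omega> = rho ` sections (sp \<omega>)"


section \<open>Exactness\<close>

text \<open>
  \<open>A \<rightarrow> B \<rightarrow> C\<close> (with maps \<open>f\<close>, \<open>g\<close>) is a sequence of additive maps, exact at \<open>B\<close>; \<open>z\<close> is the zero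
  element of \<open>C\<close>. The latter is a parameter, since the zero of a quotient by \<open>N\<close> is the coset \<open>N\<close>
  and not the constant \<open>0\<close> of the type of sets. Cosets are added by the addition of sets.
\<close>

definition additive_map :: "'a::plus set \<Rightarrow> ('a \<Rightarrow> 'b::plus) \<Rightarrow> 'b set \<Rightarrow> bool"
  where "additive_map A f B \<longleftrightarrow> f ` A \<subseteq> B \<and> (\<forall>x\<in>A. \<forall>y\<in>A. f (x + y) = f x + f y)"

definition exact_at ::
    "'a::plus set \<Rightarrow> ('a \<Rightarrow> 'b::plus) \<Rightarrow> 'b set \<Rightarrow> ('b \<Rightarrow> 'c::plus) \<Rightarrow> 'c set \<Rightarrow> 'c \<Rightarrow> bool"
  where "exact_at A f B g C z \<longleftrightarrow>
    additive_map A f B \<and> additive_map B g C \<and> f ` A = {b \<in> B. g b = z}"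


section \<open>The operators on decomposable elements\<close>

lemma contract_tensor: "contract v (\<alpha> \<otimes>\<^sub>f u) = contract v \<alpha> \<otimes>\<^sub>f u"
  by (simp add: contract_def tensor_def)

lemma d_tensor: "d q (\<alpha> \<otimes>\<^sub>f v) = (\<Sum>e\<in>Basis. (q \<bullet> e) *\<^sub>R (contract e \<alpha> \<otimes>\<^sub>f v))"
  by (simp add: d_def contract_tensor)

lemma del_tensor: "del q (\<alpha> \<otimes>\<^sub>f \<tau>) = - (\<Sum>e\<in>Basis. (q \<bullet> e) *\<^sub>R (contract e \<alpha> \<otimes>\<^sub>f \<tau>))"
  by (simp add: del_def contract_tensor)

lemma phi_tensor:
  assumes "\<omega> \<in> two_forms"
  shows "phi \<omega> i (\<alpha> \<otimes>\<^sub>f X) =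
    (-1) ^ (i - 1) *\<^sub>R (\<Sum>e\<in>Basis. contract e \<alpha> \<otimes>\<^sub>f wedge (\<lambda>x. x \<bullet> e) (\<omega> X))"
proof -
  have "\<omega> (c *\<^sub>R X) y = c * \<omega> X y" for c y
    using assms bilinear_lmul[of \<omega> c X y] by (simp add: two_forms_def)
  then have "wedge (\<lambda>x. x \<bullet> e) (\<omega> (c *\<^sub>R X)) = c *\<^sub>R wedge (\<lambda>x. x \<bullet> e) (\<omega> X)" for c e
    by (auto simp: wedge_def fun_eq_iff algebra_simps)
  then show ?thesis
    by (simp add: phi_def contract_tensor) (simp add: tensor_def)
qed

lemma forms_compose_linear:
  assumes "\<eta> \<in> forms p U" and "linear f"
  shows "(\<lambda>xs. f (\<eta> xs)) \<in> forms p UNIV"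
proof -
  have "linear (\<lambda>v. f (\<eta> (xs[i := v])))" if "length xs = p" "i < p" for xs i
    using assms that linear_compose[of "\<lambda>v. \<eta> (xs[i := v])" f]
    by (auto simp: forms_def o_def)
  then show ?thesis
    using assms by (auto simp: forms_def linear_0)
qed

lemma forms_UNIV_decompose:
  fixes \<eta> :: "'v::euclidean_space list \<Rightarrow> 'v"
  assumes "\<eta> \<in> forms p UNIV"
  shows "\<exists>\<alpha>. (\<forall>b. \<alpha> b \<in> forms p UNIV) \<and> \<eta> = (\<Sum>b\<in>Basis. \<alpha> b \<otimes>\<^sub>f b)"
proof (intro exI conjI allI)
  show "(\<lambda>xs. \<eta> xs \<bullet> b) \<in> forms p UNIV" for b
    by (rule forms_compose_linear[OF assms])
       (simp add: bounded_linear.linear bounded_linear_inner_left)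
  show "\<eta> = (\<Sum>b\<in>Basis. (\<lambda>xs. \<eta> xs \<bullet> b) \<otimes>\<^sub>f b)"
    by (rule ext) (simp add: sum_fun_apply tensor_def euclidean_representation)
qed

lemma two_forms_decompose:
  fixes B :: "'v::euclidean_space \<Rightarrow> 'v \<Rightarrow> real"
  assumes "B \<in> two_forms"
  shows "B = (\<Sum>b\<in>Basis. \<Sum>c\<in>Basis. (B b c / 2) *\<^sub>R wedge (\<lambda>x. x \<bullet> b) (\<lambda>x. x \<bullet> c))"
proof (intro ext)
  fix x y :: 'v
  have bil: "bilinear B" and alt: "B z z = 0" for z
    using assms by (auto simp: two_forms_def)
  have expand: "B x y = (\<Sum>b\<in>Basis. \<Sum>c\<in>Basis. (x \<bullet> b) * (y \<bullet> c) * B b c)" for x y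
  proof -
    have "B x y = B (\<Sum>b\<in>Basis. (x \<bullet> b) *\<^sub>R b) (\<Sum>c\<in>Basis. (y \<bullet> c) *\<^sub>R c)"
      by (simp add: euclidean_representation)
    also have "\<dots> = (\<Sum>(b,c)\<in>Basis \<times> Basis. B ((x \<bullet> b) *\<^sub>R b) ((y \<bullet> c) *\<^sub>R c))"
      using bil by (simp add: bilinear_sum)
    also have "\<dots> = (\<Sum>b\<in>Basis. \<Sum>c\<in>Basis. (x \<bullet> b) * (y \<bullet> c) * B b c)"
      using bil by (simp add: sum.cartesian_product bilinear_lmul bilinear_rmul mult.assoc)
    finally show ?thesis .
  qed
  have "B (x + y) (x + y) = B x x + B x y + B y x + B y y"
    using bil by (simp add: bilinear_ladd bilinear_radd)
  then have "B y x = - B x y"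
    using alt by simp
  then have "B x y = (B x y - B y x) / 2"
    by simp
  also have "\<dots> = (\<Sum>b\<in>Basis. \<Sum>c\<in>Basis. B b c / 2 * ((x \<bullet> b) * (y \<bullet> c) - (y \<bullet> b) * (x \<bullet> c)))"
    unfolding expand[of x y] expand[of y x]
    by (simp add: sum_subtractf [symmetric] sum_divide_distrib algebra_simps diff_divide_distrib)
  finally show "B x y = (\<Sum>b\<in>Basis. \<Sum>c\<in>Basis.
      (B b c / 2) *\<^sub>R wedge (\<lambda>x. x \<bullet> b) (\<lambda>x. x \<bullet> c)) x y"
    by (simp add: sum_fun_apply wedge_def)
qed

lemma forms_two_forms_decompose:
  fixes \<eta> :: "'v::euclidean_space list \<Rightarrow> 'v \<Rightarrow> 'v \<Rightarrow> real"
  assumes "\<eta> \<in> forms p two_forms"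
  shows "\<exists>\<alpha>. (\<forall>b c. \<alpha> b c \<in> forms p UNIV) \<and>
    \<eta> = (\<Sum>b\<in>Basis. \<Sum>c\<in>Basis. \<alpha> b c \<otimes>\<^sub>f wedge (\<lambda>x. x \<bullet> b) (\<lambda>x. x \<bullet> c))"
proof (intro exI conjI allI)
  show "(\<lambda>xs. \<eta> xs b c / 2) \<in> forms p UNIV" for b c
    by (rule forms_compose_linear[OF assms, where f = "\<lambda>B. B b c / 2"])
       (auto intro!: linearI simp: plus_fun_def add_divide_distrib)
  show "\<eta> = (\<Sum>b\<in>Basis. \<Sum>c\<in>Basis. (\<lambda>xs. \<eta> xs b c / 2) \<otimes>\<^sub>f wedge (\<lambda>x. x \<bullet> b) (\<lambda>x. x \<bullet> c))"
  proof
    fix xs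
    have "\<eta> xs \<in> two_forms"
      using assms by (auto simp: forms_def)
    from two_forms_decompose[OF this]
    show "\<eta> xs = (\<Sum>b\<in>Basis. \<Sum>c\<in>Basis.
        (\<lambda>xs. \<eta> xs b c / 2) \<otimes>\<^sub>f wedge (\<lambda>x. x \<bullet> b) (\<lambda>x. x \<bullet> c)) xs"
      by (simp add: sum_fun_apply tensor_def)
  qed
qed

end

theory Submission
  imports Defs
begin

text \<open>
  Both \<open>d\<close> and \<open>- \<partial>\<close> contract a form at the point \<open>q\<close> with \<open>q\<close> itself, that is, with the Euler
  vector field. So \<open>\<Gamma>(\<And>\<^sup>iV\<^sup>* \<otimes> V)\<close> and \<open>\<Gamma>(\<And>\<^sup>i\<^sup>-\<^sup>1V\<^sup>* \<otimes> \<And>\<^sup>2V\<^sup>*)\<close> are Koszul complexes with smooth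
  coefficients, and \<open>\<phi>\<^sup>\<omega>\<close> is a morphism between them (lemma \<open>phi_contract\<close>). The sequence is a
  piece of the long exact sequence of this morphism, for two reasons.

  First, \<open>\<phi>\<^sup>\<omega>_i\<close> is injective for \<open>i \<ge> 2\<close> (\<open>phi_injective\<close>), bijective for \<open>i = 2\<close>
  (\<open>phi2_surjective\<close>), and has kernel \<open>sp(V,\<omega>)\<close> for \<open>i = 1\<close> (\<open>phi1_eq_0_iff\<close>). All of this is
  multilinear algebra of tensors with two or three indices, after \<open>\<omega>\<close> has identified \<open>V\<close> with its dual.

  Second, the Koszul complexes are exact in positive form degree (\<open>koszul_exact\<close>). The homotopy
  combines the exterior derivative with the radial integrals \<open>\<integral> t\<^sup>m g(tq) dt\<close> over \<open>[0,1]\<close>, which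
  invert the Lie derivative along the Euler field on forms of positive degree and preserve
  smoothness.

  Sections of the cokernels lift to smooth sections of forms, since a quotient of vector spaces
  splits linearly (\<open>quotient_sections_eq\<close>). Given a section \<open>b\<close> representing an element of the
  kernel, one writes \<open>\<iota>\<^sub>q b = \<phi> a\<close>; the section \<open>a\<close> is a Koszul cycle, either because the next
  \<open>\<phi>\<close> is injective or, at \<open>C\<^sub>3\<close>, because the connecting map vanishes. Two applications of Koszul
  exactness then show that \<open>b\<close> is a boundary modulo the image of \<open>\<phi>\<close> (\<open>koszul_pair_chase\<close>). At
  \<open>sp(V,\<omega>)\<close> the same two applications lead from a section \<open>A\<close> with \<open>\<rho>(A) = 0\<close> to a preimage in
  \<open>\<Gamma>(C\<^sub>3)\<close> (\<open>exact_at_sp\<close>). Injectivity at the left end holds because \<open>(n+1)\<close>-forms vanish.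
\<close>

section \<open>Smooth functions and radial averages\<close>

lemma k_times_differentiable_SucI:
  assumes "\<And>x. (f has_derivative f' x) (at x)"
    and "\<And>v. k_times_differentiable k (\<lambda>x. f' x v)"
  shows "k_times_differentiable (Suc k) f"
proof -
  have "f' x = frechet_derivative f (at x)" for x
    using assms(1) by (rule frechet_derivative_at)
  then show ?thesis
    using assms by (auto simp: differentiable_def)
qed

lemma k_times_differentiable_SucD:
  assumes "k_times_differentiable (Suc k) f"
  shows "(f has_derivative frechet_derivative f (at x)) (at x)"
    and "k_times_differentiable k (\<lambda>x. frechet_derivative f (at x) v)"
  using assms by (auto simp: frechet_derivative_works)

lemma k_times_differentiable_mono:
  "k_times_differentiable (Suc k) f \<Longrightarrow> k_times_differentiable k f"
proof (induction k arbitrary: f)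
  case 0
  then show ?case
    by (auto intro!: differentiable_imp_continuous_on simp: differentiable_on_def differentiable_at_withinI)
next
  case (Suc k)
  then show ?case
    by (metis k_times_differentiable.simps(2))
qed

lemma k_times_differentiable_imp_continuous:
  "k_times_differentiable k f \<Longrightarrow> continuous_on UNIV f"
  by (induction k) (auto dest: k_times_differentiable_mono simp del: k_times_differentiable.simps(2))

lemma k_times_differentiable_const: "k_times_differentiable k (\<lambda>x. c)"
proof (induction k arbitrary: c)
  case (Suc k)
  show ?case by (rule k_times_differentiable_SucI[OF has_derivative_const Suc])
qed simp

lemma k_times_differentiable_linear:
  assumes "linear f" shows "k_times_differentiable k f"
proof (cases k)
  case 0
  then show ?thesis using assms by (simp add: linear_continuous_on linear_linear)
next
  case (Suc k)
  then show ?thesis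
    using assms k_times_differentiable_SucI[OF bounded_linear_imp_has_derivative[of f] k_times_differentiable_const]
    by (simp add: linear_linear)
qed

lemma k_times_differentiable_add:
  "k_times_differentiable k f \<Longrightarrow> k_times_differentiable k g \<Longrightarrow>
    k_times_differentiable k (\<lambda>x. f x + g x)"
proof (induction k arbitrary: f g)
  case 0
  then show ?case by (simp add: continuous_on_add)
next
  case (Suc k)
  show ?case
    by (rule k_times_differentiable_SucI[OF has_derivative_add[OF k_times_differentiable_SucD(1)[OF Suc.prems(1)]
          k_times_differentiable_SucD(1)[OF Suc.prems(2)]]])
       (intro Suc.IH k_times_differentiable_SucD(2) Suc.prems)
qed

lemma k_times_differentiable_mult:
  "k_times_differentiable k f \<Longrightarrow> k_times_differentiable k g \<Longrightarrow>
    k_times_differentiable k (\<lambda>x. f x * g x)"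
proof (induction k arbitrary: f g)
  case 0
  then show ?case by (simp add: continuous_on_mult)
next
  case (Suc k)
  show ?case
    by (rule k_times_differentiable_SucI[OF has_derivative_mult[OF k_times_differentiable_SucD(1)[OF Suc.prems(1)]
          k_times_differentiable_SucD(1)[OF Suc.prems(2)]]])
       (intro k_times_differentiable_add Suc.IH k_times_differentiable_SucD(2) Suc.prems
          k_times_differentiable_mono[OF Suc.prems(1)] k_times_differentiable_mono[OF Suc.prems(2)])
qed

lemma smooth_const: "smooth (\<lambda>x. c)"
  by (simp add: smooth_def k_times_differentiable_const)

lemma smooth_linear: "linear f \<Longrightarrow> smooth f"
  by (simp add: smooth_def k_times_differentiable_linear)

lemma smooth_add: "smooth f \<Longrightarrow> smooth g \<Longrightarrow> smooth (\<lambda>x. f x + g x)"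
  by (simp add: smooth_def k_times_differentiable_add)

lemma smooth_mult: "smooth f \<Longrightarrow> smooth g \<Longrightarrow> smooth (\<lambda>x. f x * g x)"
  by (simp add: smooth_def k_times_differentiable_mult)

lemma smooth_sum: "(\<And>i. i \<in> I \<Longrightarrow> smooth (f i)) \<Longrightarrow> smooth (\<lambda>x. \<Sum>i\<in>I. f i x)"
  by (induction I rule: infinite_finite_induct) (auto intro: smooth_const smooth_add)

lemma smooth_has_derivative:
  "smooth f \<Longrightarrow> (f has_derivative frechet_derivative f (at x)) (at x)"
  unfolding smooth_def using k_times_differentiable_SucD(1) by blast

lemma smooth_frechet_derivative:
  "smooth f \<Longrightarrow> smooth (\<lambda>x. frechet_derivative f (at x) v)"
  unfolding smooth_def using k_times_differentiable_SucD(2) by blast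

lemma smooth_continuous: "smooth f \<Longrightarrow> continuous_on UNIV f"
  unfolding smooth_def using k_times_differentiable_imp_continuous by blast

definition radial_integral :: "nat \<Rightarrow> ('v::euclidean_space \<Rightarrow> real) \<Rightarrow> 'v \<Rightarrow> real"
  where "radial_integral m g q = integral {0..1} (\<lambda>t. t ^ m * g (t *\<^sub>R q))"

lemma radial_integrable:
  fixes g :: "'v::euclidean_space \<Rightarrow> real"
  assumes "continuous_on UNIV g"
  shows "(\<lambda>t. t ^ m * g (t *\<^sub>R q)) integrable_on {0..1}"
  by (intro integrable_continuous_interval continuous_intros
      continuous_on_compose2[OF assms]) auto

text \<open>
  The chain rule contributes a factor \<open>t\<close>, which is why the exponent rises by one. Since the
  derivative is again a radial integral, this one step of differentiation under the integral sign
  yields smoothness to all orders by induction.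
\<close>
lemma has_derivative_radial_integral:
  fixes g :: "'v::euclidean_space \<Rightarrow> real"
  assumes g: "k_times_differentiable (Suc k) g"
  shows "(radial_integral m g has_derivative
    (\<lambda>v. radial_integral (Suc m) (\<lambda>x. frechet_derivative g (at x) v) q)) (at q)"
proof -
  define D where "D = (\<lambda>x. frechet_derivative g (at x))"
  have der: "(g has_derivative D x) (at x)" for x
    unfolding D_def by (rule k_times_differentiable_SucD(1)[OF g])
  then have bl: "bounded_linear (D x)" for x
    by (rule has_derivative_bounded_linear)
  have contD: "continuous_on UNIV (\<lambda>x. D x v)" for v
    unfolding D_def
    by (rule k_times_differentiable_imp_continuous[OF k_times_differentiable_SucD(2)[OF g]])
  have contg: "continuous_on UNIV g"
    by (rule k_times_differentiable_imp_continuous[OF g])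
  define F where "F = (\<lambda>x t. t ^ Suc m *\<^sub>R Blinfun (D (t *\<^sub>R x)))"
  have F: "blinfun_apply (F x t) v = t ^ Suc m * D (t *\<^sub>R x) v" for x t v
    by (simp add: F_def blinfun.scaleR_left bounded_linear_Blinfun_apply[OF bl])
  have contF: "continuous_on (UNIV \<times> cbox 0 (1::real)) (\<lambda>(x, t). F x t)"
  proof (rule continuous_on_blinfun_componentwise)
    fix i :: 'v
    show "continuous_on (UNIV \<times> cbox 0 1) (\<lambda>z. blinfun_apply (case z of (x, t) \<Rightarrow> F x t) i)"
      unfolding split_beta F
      by (intro continuous_intros continuous_on_compose2[OF contD]) auto
  qed
  have intF: "F q integrable_on cbox 0 1"
  proof (rule integrable_continuous)
    show "continuous_on (cbox 0 1) (F q)"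
      using continuous_on_compose2[OF contF, of "cbox 0 1" "\<lambda>t. (q, t)"]
      by (simp add: continuous_intros image_subset_iff)
  qed
  have "((\<lambda>x. integral (cbox 0 1) (\<lambda>t. t ^ m * g (t *\<^sub>R x))) has_derivative
      blinfun_apply (integral (cbox 0 1) (F q))) (at q within UNIV)"
  proof (rule leibniz_rule[OF _ _ contF])
    show "((\<lambda>x. t ^ m * g (t *\<^sub>R x)) has_derivative blinfun_apply (F x t)) (at x within UNIV)" for x t
    proof -
      have "((\<lambda>x. g (t *\<^sub>R x)) has_derivative (\<lambda>v. D (t *\<^sub>R x) (t *\<^sub>R v))) (at x)"
        by (rule has_derivative_compose[of "\<lambda>x. t *\<^sub>R x" _ x UNIV, OF _ der])
           (auto intro!: derivative_eq_intros)
      from has_derivative_mult_right[OF this, of "t ^ m"]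
      have "((\<lambda>x. t ^ m * g (t *\<^sub>R x)) has_derivative (\<lambda>v. t ^ m * D (t *\<^sub>R x) (t *\<^sub>R v))) (at x)" .
      moreover have "(\<lambda>v. t ^ m * D (t *\<^sub>R x) (t *\<^sub>R v)) = blinfun_apply (F x t)"
        using linear_simps(5)[OF bl] by (auto simp: F)
      ultimately show ?thesis by simp
    qed
    show "(\<lambda>t. t ^ m * g (t *\<^sub>R x)) integrable_on cbox 0 1" for x
      using radial_integrable[OF contg] by simp
  qed auto
  moreover have "blinfun_apply (integral (cbox 0 1) (F q)) =
      (\<lambda>v. radial_integral (Suc m) (\<lambda>x. D x v) q)"
    by (rule ext) (simp add: blinfun_apply_integral[OF intF[unfolded cbox_interval]] F radial_integral_def del: power_Suc)
  ultimately show ?thesis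
    by (simp add: radial_integral_def[abs_def] D_def)
qed

lemma k_times_differentiable_radial_integral:
  "k_times_differentiable k g \<Longrightarrow> k_times_differentiable k (radial_integral m g)"
proof (induction k arbitrary: g m)
  case 0
  then have *: "continuous_on UNIV g" by simp
  have "continuous_on (UNIV \<times> cbox 0 1) (\<lambda>(q, t). t ^ m * g (t *\<^sub>R q))"
    unfolding split_beta by (intro continuous_intros continuous_on_compose2[OF *]) auto
  from integral_continuous_on_param[OF this] show ?case
    by (simp add: radial_integral_def[abs_def])
next
  case (Suc k)
  show ?case
    by (rule k_times_differentiable_SucI[OF has_derivative_radial_integral[OF Suc.prems]])
       (intro Suc.IH k_times_differentiable_SucD(2)[OF Suc.prems])
qed

lemma smooth_radial_integral: "smooth g \<Longrightarrow> smooth (radial_integral m g)"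
  by (simp add: smooth_def k_times_differentiable_radial_integral)

lemma radial_integral_sum:
  assumes "\<And>i. i \<in> I \<Longrightarrow> smooth (g i)"
  shows "radial_integral m (\<lambda>x. \<Sum>i\<in>I. c i * g i x) q = (\<Sum>i\<in>I. c i * radial_integral m (g i) q)"
proof (cases "finite I")
  case True
  have "radial_integral m (\<lambda>x. \<Sum>i\<in>I. c i * g i x) q =
      integral {0..1} (\<lambda>t. \<Sum>i\<in>I. c i * (t ^ m * g i (t *\<^sub>R q)))"
    by (simp add: radial_integral_def sum_distrib_left algebra_simps)
  also have "\<dots> = (\<Sum>i\<in>I. integral {0..1} (\<lambda>t. c i * (t ^ m * g i (t *\<^sub>R q))))"
    using True assms
    by (intro integral_sum integrable_on_mult_right radial_integrable smooth_continuous)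
  finally show ?thesis
    by (simp add: radial_integral_def)
qed (simp add: radial_integral_def)

text \<open>
  This is \<open>\<integral> (t\<^sup>m\<^sup>+\<^sup>1 c(tq))' dt = c(q)\<close>: the boundary term at \<open>t = 0\<close> drops out because the
  exponent \<open>m + 1\<close> is positive. It says that \<open>radial_integral m\<close> inverts the operator
  \<open>E + (m + 1)\<close>, where \<open>E\<close> is the Euler vector field.
\<close>
lemma radial_integral_euler:
  fixes c :: "'v::euclidean_space \<Rightarrow> real"
  assumes "smooth c"
  shows "(\<Sum>e\<in>Basis. (q \<bullet> e) * radial_integral (Suc m) (\<lambda>x. frechet_derivative c (at x) e) q) =
    c q - Suc m * radial_integral m c q"
proof -
  define D where "D = (\<lambda>x. frechet_derivative c (at x))"
  have der: "(c has_derivative D x) (at x)" for x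
    unfolding D_def by (rule smooth_has_derivative[OF assms])
  then have lin: "linear (D x)" for x
    by (rule has_derivative_linear)
  have "(\<Sum>e\<in>Basis. (q \<bullet> e) * radial_integral (Suc m) (\<lambda>x. D x e) q) =
      radial_integral (Suc m) (\<lambda>x. \<Sum>e\<in>Basis. (q \<bullet> e) * D x e) q"
    unfolding D_def by (rule radial_integral_sum[symmetric]) (rule smooth_frechet_derivative[OF assms])
  also have "(\<lambda>x. \<Sum>e\<in>Basis. (q \<bullet> e) * D x e) = (\<lambda>x. D x q)"
  proof
    fix x
    have "D x q = D x (\<Sum>e\<in>Basis. (q \<bullet> e) *\<^sub>R e)" by (simp add: euclidean_representation)
    then show "(\<Sum>e\<in>Basis. (q \<bullet> e) * D x e) = D x q"
      by (simp add: linear_sum[OF lin] linear_cmul[OF lin] o_def)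
  qed
  finally have sum: "(\<Sum>e\<in>Basis. (q \<bullet> e) * radial_integral (Suc m) (\<lambda>x. D x e) q) =
    radial_integral (Suc m) (\<lambda>x. D x q) q" .
  have "((\<lambda>t. Suc m * (t ^ m * c (t *\<^sub>R q)) + t ^ Suc m * D (t *\<^sub>R q) q) has_integral
      1 ^ Suc m * c (1 *\<^sub>R q) - 0 ^ Suc m * c (0 *\<^sub>R q)) {0..1::real}"
  proof (rule fundamental_theorem_of_calculus)
    fix t :: real
    have "((\<lambda>t. c (t *\<^sub>R q)) has_derivative (\<lambda>h. D (t *\<^sub>R q) (h *\<^sub>R q))) (at t within {0..1})"
      by (rule has_derivative_compose[of "\<lambda>t. t *\<^sub>R q", OF _ der])
         (auto intro!: derivative_eq_intros)
    then have "((\<lambda>t. c (t *\<^sub>R q)) has_real_derivative D (t *\<^sub>R q) q) (at t within {0..1})"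
      by (simp add: has_field_derivative_def linear_cmul[OF lin] mult_commute_abs)
    moreover have "((\<lambda>t. t ^ Suc m) has_real_derivative Suc m * t ^ m) (at t within {0..1})"
      using DERIV_subset[OF DERIV_pow[of "Suc m" t]] by auto
    ultimately show "((\<lambda>t. t ^ Suc m * c (t *\<^sub>R q)) has_vector_derivative
        Suc m * (t ^ m * c (t *\<^sub>R q)) + t ^ Suc m * D (t *\<^sub>R q) q) (at t within {0..1})"
      unfolding has_real_derivative_iff_has_vector_derivative[symmetric]
      by (auto intro: DERIV_cong[OF DERIV_mult])
  qed simp
  then have "integral {0..1} (\<lambda>t. Suc m * (t ^ m * c (t *\<^sub>R q)) + t ^ Suc m * D (t *\<^sub>R q) q) = c q"
    by (simp add: integral_unique)
  moreover have "integral {0..1} (\<lambda>t. Suc m * (t ^ m * c (t *\<^sub>R q)) + t ^ Suc m * D (t *\<^sub>R q) q) =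
      Suc m * radial_integral m c q + radial_integral (Suc m) (\<lambda>x. D x q) q"
    unfolding radial_integral_def
    by (subst integral_add)
       (auto intro!: integrable_on_mult_right radial_integrable smooth_continuous assms
          smooth_frechet_derivative simp: D_def simp del: power_Suc of_nat_Suc)
  ultimately show ?thesis
    using sum unfolding D_def by simp
qed

text \<open>
  Differentiating the relation \<open>\<Sum> c\<^sub>k(x) A\<^sub>k(x) = 0\<close> in direction \<open>v\<close> gives
  \<open>\<Sum> D\<^sub>v c\<^sub>k(x) A\<^sub>k(x) = - \<Sum> c\<^sub>k(x) A\<^sub>k(v)\<close>. At \<open>x = tq\<close> the linear maps \<open>A\<^sub>k\<close> release one factor
  \<open>t\<close> on the left, so that integration against \<open>t\<^sup>m\<close> produces radial integrals with different
  exponents on the two sides.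
\<close>
lemma radial_integral_relation:
  fixes c :: "'k \<Rightarrow> 'v::euclidean_space \<Rightarrow> real"
  assumes c: "\<And>k. k \<in> K \<Longrightarrow> smooth (c k)" and A: "\<And>k. k \<in> K \<Longrightarrow> linear (A k)"
    and rel: "\<And>x. (\<Sum>k\<in>K. c k x * A k x) = 0"
  shows "(\<Sum>k\<in>K. radial_integral (Suc m) (\<lambda>x. frechet_derivative (c k) (at x) v) q * A k q) =
    - (\<Sum>k\<in>K. radial_integral m (c k) q * A k v)"
proof -
  have D: "(\<Sum>k\<in>K. A k x * frechet_derivative (c k) (at x) v) = (\<Sum>k\<in>K. (- A k v) * c k x)" for x
  proof -
    have "((\<lambda>x. \<Sum>k\<in>K. c k x * A k x) has_derivative
        (\<lambda>v. \<Sum>k\<in>K. c k x * A k v + frechet_derivative (c k) (at x) v * A k x)) (at x)"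
      by (intro has_derivative_sum has_derivative_mult smooth_has_derivative[OF c]
          bounded_linear_imp_has_derivative) (use A in \<open>auto simp: linear_linear\<close>)
    moreover have "((\<lambda>x. \<Sum>k\<in>K. c k x * A k x) has_derivative (\<lambda>v. 0)) (at x)"
      unfolding rel by simp
    ultimately have "(\<lambda>v. \<Sum>k\<in>K. c k x * A k v + frechet_derivative (c k) (at x) v * A k x) = (\<lambda>v. 0)"
      by (rule has_derivative_unique)
    from fun_cong[OF this, of v] show ?thesis
      by (simp add: sum.distrib sum_negf algebra_simps)
  qed
  have "(\<Sum>k\<in>K. A k q * radial_integral (Suc m) (\<lambda>x. frechet_derivative (c k) (at x) v) q) =
      radial_integral (Suc m) (\<lambda>x. \<Sum>k\<in>K. A k q * frechet_derivative (c k) (at x) v) q"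
    by (rule radial_integral_sum[symmetric]) (rule smooth_frechet_derivative[OF c])
  also have "\<dots> = radial_integral m (\<lambda>x. \<Sum>k\<in>K. (- A k v) * c k x) q"
    unfolding radial_integral_def
  proof (intro arg_cong[where f = "integral {0..1}"] ext)
    fix t :: real
    have "t ^ Suc m * (\<Sum>k\<in>K. A k q * frechet_derivative (c k) (at (t *\<^sub>R q)) v) =
        t ^ m * (\<Sum>k\<in>K. A k (t *\<^sub>R q) * frechet_derivative (c k) (at (t *\<^sub>R q)) v)"
      by (auto simp: linear_cmul[OF A] sum_distrib_left algebra_simps intro!: sum.cong)
    then show "t ^ Suc m * (\<Sum>k\<in>K. A k q * frechet_derivative (c k) (at (t *\<^sub>R q)) v) =
        t ^ m * (\<Sum>k\<in>K. - A k v * c k (t *\<^sub>R q))"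
      by (simp only: D)
  qed
  also have "\<dots> = (\<Sum>k\<in>K. (- A k v) * radial_integral m (c k) q)"
    by (rule radial_integral_sum) (rule c)
  finally show ?thesis
    by (simp add: sum_negf mult.commute)
qed

section \<open>Contraction and exterior multiplication of forms\<close>

lemma forms_memD:
  assumes "\<eta> \<in> forms p U"
  shows "\<eta> xs \<in> U" and "length xs \<noteq> p \<Longrightarrow> \<eta> xs = 0"
    and "length xs = p \<Longrightarrow> i < p \<Longrightarrow> linear (\<lambda>v. \<eta> (xs[i := v]))"
    and "\<not> distinct xs \<Longrightarrow> \<eta> xs = 0"
  using assms unfolding forms_def by auto

lemma subspace_forms:
  fixes U :: "'u::real_vector set"
  assumes "subspace U"
  shows "subspace (forms p U :: ('v::euclidean_space list \<Rightarrow> 'u) set)"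
  unfolding subspace_def
proof (intro conjI ballI allI)
  show "0 \<in> (forms p U :: ('v list \<Rightarrow> 'u) set)"
    using subspace_0[OF assms] by (simp add: forms_def linear_zero)
  fix \<eta> \<zeta> :: "'v list \<Rightarrow> 'u" and c :: real
  assume \<eta>: "\<eta> \<in> forms p U"
  show "c *\<^sub>R \<eta> \<in> forms p U"
    using \<eta> assms by (auto simp: forms_def intro: subspace_scale linear_compose_scale_right)
  assume "\<zeta> \<in> forms p U"
  with \<eta> show "\<eta> + \<zeta> \<in> forms p U"
    using assms by (auto simp: forms_def intro: subspace_add linear_compose_add)
qed

lemma linear_contract: "linear (contract v)"
  by (rule linearI) (auto simp: contract_def fun_eq_iff)

text \<open>
  On a list of the wrong length the map is zero, hence linear as well. Stated for all lists, the
  lemma applies pointwise to contractions, which are functions of lists of every length.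
\<close>
lemma form_linear_head:
  assumes "\<eta> \<in> forms p U" shows "linear (\<lambda>v. \<eta> (v # xs))"
proof (cases "length xs = p - 1 \<and> 0 < p")
  case True
  then show ?thesis
    \<comment> \<open>The first entry is overwritten by the update, so its value is arbitrary.\<close>
    using forms_memD(3)[OF assms, of "undefined # xs" 0] by (cases p) auto
next
  case False
  then have "(\<lambda>v. \<eta> (v # xs)) = (\<lambda>v. 0)"
    using forms_memD(2)[OF assms] by (cases p) auto
  then show ?thesis by (simp add: linear_zero)
qed

lemma contract_in_forms:
  assumes "\<eta> \<in> forms (Suc p) U" shows "contract v \<eta> \<in> forms p U"
proof -
  have "linear (\<lambda>w. \<eta> (v # xs[i := w]))" if "length xs = p" "i < p" for xs i
    using forms_memD(3)[OF assms, of "v # xs" "Suc i"] that by simp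
  then show ?thesis
    using assms unfolding forms_def contract_def by auto
qed

lemma contract_0_form:
  assumes "\<eta> \<in> forms 0 U" shows "contract v \<eta> = 0"
  using forms_memD(2)[OF assms] by (auto simp: contract_def fun_eq_iff)

lemma linear_contract_head:
  assumes "\<eta> \<in> forms p U" shows "linear (\<lambda>v. contract v \<eta>)"
  unfolding contract_def
  by (rule linearI)
     (auto simp: fun_eq_iff linear_add[OF form_linear_head[OF assms]] linear_cmul[OF form_linear_head[OF assms]])

lemma sum_contract_Basis:
  assumes "\<eta> \<in> forms p U" shows "(\<Sum>e\<in>Basis. (q \<bullet> e) *\<^sub>R contract e \<eta>) = contract q \<eta>"
proof -
  have "contract q \<eta> = contract (\<Sum>e\<in>Basis. (q \<bullet> e) *\<^sub>R e) \<eta>"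
    by (simp add: euclidean_representation)
  also have "\<dots> = (\<Sum>e\<in>Basis. (q \<bullet> e) *\<^sub>R contract e \<eta>)"
    by (simp add: linear_sum[OF linear_contract_head[OF assms]] linear_cmul[OF linear_contract_head[OF assms]])
  finally show ?thesis ..
qed

lemma contract_self:
  assumes "\<eta> \<in> forms p U" shows "contract x (contract x \<eta>) = 0"
  using forms_memD(4)[OF assms] by (auto simp: contract_def fun_eq_iff)

lemma contract_anticommute:
  assumes "\<eta> \<in> forms p U"
  shows "contract x (contract y \<eta>) = - contract y (contract x \<eta>)"
proof -
  note add = linear_add[OF linear_contract_head[OF assms]] linear_add[OF linear_contract]
  have "0 = contract (x + y) (contract (x + y) \<eta>)"
    by (simp add: contract_self[OF assms])
  also have "\<dots> = contract (x + y) (contract x \<eta>) + contract (x + y) (contract y \<eta>)"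
    by (simp add: add)
  also have "\<dots> = contract x (contract x \<eta>) + contract y (contract x \<eta>) +
      (contract x (contract y \<eta>) + contract y (contract y \<eta>))"
  proof -
    have "contract (x + y) (contract z \<eta>) = contract x (contract z \<eta>) + contract y (contract z \<eta>)" for z
    proof (cases p)
      case 0
      then have "contract z \<eta> = 0"
        using contract_0_form assms by blast
      then show ?thesis by (simp add: linear_0[OF linear_contract])
    next
      case (Suc m)
      then show ?thesis
        using linear_add[OF linear_contract_head[OF contract_in_forms]] assms by blast
    qed
    then show ?thesis by simp
  qed
  finally show ?thesis
    by (simp add: contract_self[OF assms] eq_neg_iff_add_eq_0 add.commute)
qed

text \<open>
  Left exterior multiplication by the covector \<open>e^* = (\<bullet> e)\<close>. The recursion is the rule
  \<open>\<iota>\<^sub>x(e^* \<and> \<eta>) = e^*(x) \<eta> - e^* \<and> \<iota>\<^sub>x \<eta>\<close>, read as a definition; it replaces the usual alternating sum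
  over the omitted argument.
\<close>
primrec ext_mult :: "'v::euclidean_space \<Rightarrow> ('v list \<Rightarrow> 'u::real_vector) \<Rightarrow> 'v list \<Rightarrow> 'u" where
  "ext_mult e \<eta> [] = 0"
| "ext_mult e \<eta> (x # xs) = (x \<bullet> e) *\<^sub>R \<eta> xs - ext_mult e (contract x \<eta>) xs"

lemma ext_mult_add: "ext_mult e (\<eta> + \<zeta>) xs = ext_mult e \<eta> xs + ext_mult e \<zeta> xs"
  by (induction xs arbitrary: \<eta> \<zeta>)
     (simp_all add: linear_add[OF linear_contract] scaleR_add_right)

lemma ext_mult_scale: "ext_mult e (c *\<^sub>R \<eta>) xs = c *\<^sub>R ext_mult e \<eta> xs"
  by (induction xs arbitrary: \<eta>)
     (simp_all add: linear_cmul[OF linear_contract] scaleR_diff_right)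

lemma linear_ext_mult: "linear (ext_mult e)"
  by (rule linearI) (auto simp: ext_mult_add ext_mult_scale fun_eq_iff)

lemma ext_mult_0 [simp]: "ext_mult e 0 xs = 0"
  using fun_cong[OF linear_0[OF linear_ext_mult, of e], of xs] by (simp add: zero_fun_def)

lemma contract_ext_mult: "contract x (ext_mult e \<eta>) = (x \<bullet> e) *\<^sub>R \<eta> - ext_mult e (contract x \<eta>)"
  by (auto simp: contract_def fun_eq_iff)

text \<open>
  This says that \<open>\<iota>\<^sub>x(e^* \<and> \<eta>)\<close> vanishes on every list containing \<open>x\<close>, which is the part of the
  alternation of \<open>e^* \<and> \<eta>\<close> that does not come from a shorter list.
\<close>
lemma ext_mult_contract_mem:
  assumes "\<eta> \<in> forms p U" "x \<in> set xs" "length xs = p"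
  shows "ext_mult e (contract x \<eta>) xs = (x \<bullet> e) *\<^sub>R \<eta> xs"
  using assms
proof (induction xs arbitrary: p \<eta>)
  case (Cons y zs)
  obtain m where p: "p = Suc m"
    using Cons.prems by (cases p) auto
  show ?case
  proof (cases "y = x")
    case True
    then show ?thesis
      by (simp add: contract_self[OF Cons.prems(1)]) (simp add: contract_def)
  next
    case False
    then have x: "x \<in> set zs" using Cons.prems by simp
    then have 0: "\<eta> (x # zs) = 0"
      using forms_memD(4)[OF Cons.prems(1)] by simp
    have "ext_mult e (contract x (contract y \<eta>)) zs = (x \<bullet> e) *\<^sub>R contract y \<eta> zs"
      using Cons.prems x p by (intro Cons.IH[of "contract y \<eta>" m] contract_in_forms) auto
    moreover have "contract y (contract x \<eta>) = - contract x (contract y \<eta>)"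
      by (rule contract_anticommute[OF Cons.prems(1)])
    ultimately show ?thesis
      using 0 by (simp add: linear_neg[OF linear_ext_mult] contract_def)
  qed
qed simp

lemma ext_mult_in_forms:
  fixes \<eta> :: "'v::euclidean_space list \<Rightarrow> 'u::real_vector"
  assumes U: "subspace U" and "\<eta> \<in> forms p U"
  shows "ext_mult e \<eta> \<in> forms (Suc p) U"
proof -
  have mem: "ext_mult e \<eta> xs \<in> U" if "\<eta> \<in> forms p U" for \<eta> :: "'v list \<Rightarrow> 'u" and xs p
    using that
  proof (induction xs arbitrary: \<eta> p)
    case Nil
    then show ?case using U by (simp add: subspace_0)
  next
    case (Cons x xs)
    have "ext_mult e (contract x \<eta>) xs \<in> U"
    proof (cases p)
      case 0
      then show ?thesis using Cons.prems U by (simp add: contract_0_form subspace_0)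
    next
      case (Suc m)
      then show ?thesis using Cons contract_in_forms by blast
    qed
    then show ?case
      using U forms_memD(1)[OF Cons.prems] by (simp add: subspace_diff subspace_scale)
  qed
  have len: "ext_mult e \<eta> xs = 0" if "\<eta> \<in> forms p U" "length xs \<noteq> Suc p" for \<eta> :: "'v list \<Rightarrow> 'u" and xs p
    using that
  proof (induction xs arbitrary: \<eta> p)
    case (Cons x xs)
    then have "ext_mult e (contract x \<eta>) xs = 0"
    proof (cases p)
      case 0
      then show ?thesis using Cons.prems by (simp add: contract_0_form)
    next
      case (Suc m)
      then show ?thesis using Cons.prems by (intro Cons.IH[of _ m] contract_in_forms) auto
    qed
    then show ?case using forms_memD(2)[OF Cons.prems(1)] Cons.prems by simp
  qed simp
  have lin: "linear (\<lambda>v. ext_mult e \<eta> (xs[i := v]))"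
    if "\<eta> \<in> forms p U" "length xs = Suc p" "i < Suc p" for \<eta> :: "'v list \<Rightarrow> 'u" and xs i p
    using that
  proof (induction xs arbitrary: \<eta> p i)
    case (Cons x xs)
    show ?case
    proof (cases i)
      case 0
      have "linear (\<lambda>v. (v \<bullet> e) *\<^sub>R \<eta> xs)"
        by (rule linearI) (auto simp: inner_add_left scaleR_add_left)
      moreover have "linear (\<lambda>v. ext_mult e (contract v \<eta>) xs)"
        by (rule linearI)
           (simp_all add: linear_add[OF linear_contract_head[OF Cons.prems(1)]]
             linear_cmul[OF linear_contract_head[OF Cons.prems(1)]] ext_mult_add ext_mult_scale)
      ultimately show ?thesis
        using 0 by (simp add: linear_compose_sub)
    next
      case (Suc j)
      then obtain m where p: "p = Suc m"
        using Cons.prems by (cases p) auto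
      have "linear (\<lambda>v. ext_mult e (contract x \<eta>) (xs[j := v]))"
        using Cons p Suc by (intro Cons.IH[of _ m] contract_in_forms) auto
      moreover have "linear (\<lambda>v. (x \<bullet> e) *\<^sub>R \<eta> (xs[j := v]))"
        using Cons.prems p Suc by (intro linear_compose_scale_right forms_memD(3)) auto
      ultimately show ?thesis
        using Suc by (simp add: linear_compose_sub)
    qed
  qed simp
  have alt: "ext_mult e \<eta> xs = 0"
    if "\<eta> \<in> forms p U" "length xs = Suc p" "\<not> distinct xs" for \<eta> :: "'v list \<Rightarrow> 'u" and xs p
    using that
  proof (induction xs arbitrary: \<eta> p)
    case (Cons x xs)
    show ?case
    proof (cases "x \<in> set xs")
      case True
      then show ?thesis using ext_mult_contract_mem[OF Cons.prems(1) True] Cons.prems by simp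
    next
      case False
      then have "\<not> distinct xs" using Cons.prems by simp
      moreover from this obtain m where "p = Suc m"
        using Cons.prems by (cases p) auto
      ultimately show ?thesis
        using Cons.IH[of "contract x \<eta>" m] contract_in_forms[of \<eta> m U x] Cons.prems
          forms_memD(4)[OF Cons.prems(1)]
        by simp
    qed
  qed simp
  show ?thesis
    unfolding forms_def using assms mem len lin alt by blast
qed

text \<open>
  Euler's identity \<open>\<Sum> e^* \<and> \<iota>\<^sub>e \<eta> = p \<eta>\<close>. Peeling off the first argument \<open>x\<close> moves \<open>\<iota>\<^sub>x\<close> past
  \<open>\<iota>\<^sub>e\<close> at the cost of a sign, and thus reduces it to the identity for the \<open>(p-1)\<close>-form \<open>\<iota>\<^sub>x \<eta>\<close>.
\<close>
lemma sum_ext_mult_contract: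
  assumes "\<eta> \<in> forms p U"
  shows "(\<Sum>e\<in>Basis. ext_mult e (contract e \<eta>)) = real p *\<^sub>R \<eta>"
proof
  fix xs
  have "(\<Sum>e\<in>Basis. ext_mult e (contract e \<eta>) xs) = real p *\<^sub>R \<eta> xs"
    using assms
  proof (induction xs arbitrary: p \<eta>)
    case Nil
    then show ?case using forms_memD(2)[OF Nil, of "[]"] by auto
  next
    case (Cons x xs)
    show ?case
    proof (cases p)
      case 0
      then show ?thesis
        by (simp only: contract_0_form[OF Cons.prems[unfolded 0]] ext_mult_0) simp
    next
      case (Suc m)
      have "(\<Sum>e\<in>Basis. ext_mult e (contract e \<eta>) (x # xs)) =
          (\<Sum>e\<in>Basis. (x \<bullet> e) *\<^sub>R contract e \<eta>) xs - (\<Sum>e\<in>Basis. ext_mult e (contract x (contract e \<eta>)) xs)"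
        by (simp add: sum_subtractf sum_fun_apply)
      also have "(\<Sum>e\<in>Basis. (x \<bullet> e) *\<^sub>R contract e \<eta>) = contract x \<eta>"
        by (rule sum_contract_Basis[OF Cons.prems])
      also have "(\<Sum>e\<in>Basis. ext_mult e (contract x (contract e \<eta>)) xs) =
          - (\<Sum>e\<in>Basis. ext_mult e (contract e (contract x \<eta>)) xs)"
        by (subst contract_anticommute[OF Cons.prems])
           (simp add: linear_neg[OF linear_ext_mult] sum_negf)
      also have "(\<Sum>e\<in>Basis. ext_mult e (contract e (contract x \<eta>)) xs) = real m *\<^sub>R contract x \<eta> xs"
        using Cons.prems Suc by (intro Cons.IH contract_in_forms) simp
      finally show ?thesis
        using Suc by (simp add: contract_def algebra_simps)
    qed
  qed
  then show "(\<Sum>e\<in>Basis. ext_mult e (contract e \<eta>)) xs = (real p *\<^sub>R \<eta>) xs"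
    by (simp add: sum_fun_apply)
qed

text \<open>
  Expanding one argument after the other in the basis reduces to lists of basis vectors, which
  must repeat an entry when they are longer than the dimension.
\<close>
lemma forms_above_dim:
  fixes \<eta> :: "'v::euclidean_space list \<Rightarrow> 'u::real_vector"
  assumes \<eta>: "\<eta> \<in> forms p U" and p: "DIM('v) < p"
  shows "\<eta> = 0"
proof -
  have *: "length xs = p \<Longrightarrow> set (drop k xs) \<subseteq> Basis \<Longrightarrow> k \<le> p \<Longrightarrow> \<eta> xs = 0" for k xs
  proof (induction k arbitrary: xs)
    case 0
    have "\<not> distinct xs"
    proof
      assume "distinct xs"
      then have "length xs = card (set xs)" by (simp add: distinct_card)
      also have "\<dots> \<le> DIM('v)" using 0 by (intro card_mono) auto
      finally show False using 0 p by simp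
    qed
    then show ?case by (rule forms_memD(4)[OF \<eta>])
  next
    case (Suc k)
    have lin: "linear (\<lambda>v. \<eta> (xs[k := v]))"
      using Suc.prems by (intro forms_memD(3)[OF \<eta>]) auto
    have zero: "\<eta> (xs[k := e]) = 0" if "e \<in> Basis" for e
    proof (rule Suc.IH)
      have "drop k (xs[k := e]) = e # drop (Suc k) xs"
        using Suc.prems by (simp add: Cons_nth_drop_Suc[symmetric])
      then show "set (drop k (xs[k := e])) \<subseteq> Basis"
        using Suc.prems that by simp
    qed (use Suc.prems in auto)
    have "\<eta> xs = \<eta> (xs[k := (\<Sum>e\<in>Basis. (xs ! k \<bullet> e) *\<^sub>R e)])"
      by (simp add: euclidean_representation)
    also have "\<dots> = (\<Sum>e\<in>Basis. (xs ! k \<bullet> e) *\<^sub>R \<eta> (xs[k := e]))"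
      by (simp add: linear_sum[OF lin] linear_cmul[OF lin])
    finally show ?case using zero by simp
  qed
  show ?thesis
  proof
    fix xs show "\<eta> xs = 0 xs"
      using *[of xs p] forms_memD(2)[OF \<eta>, of xs] by (cases "length xs = p") auto
  qed
qed

text \<open>
  By \<open>\<eta> = \<Sum> e^* \<otimes> \<iota>\<^sub>e \<eta>\<close> the \<open>(p+1)\<close>-forms are spanned by the images of the \<open>p\<close>-forms under the
  linear maps \<open>e^* \<otimes> -\<close>. These images are not alternating, so the spanning set lies in the ambient
  space of all functions on lists.
\<close>
lemma forms_finite_span:
  fixes U :: "'u::real_vector set"
  assumes "finite T" "U \<subseteq> span T"
  shows "\<exists>S. finite S \<and> (forms p U :: ('v::euclidean_space list \<Rightarrow> 'u) set) \<subseteq> span S"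
proof (induction p)
  case 0
  define L where "L = (\<lambda>u::'u. \<lambda>xs::'v list. if xs = [] then u else 0)"
  have lin: "linear L"
    by (rule linearI) (auto simp: L_def fun_eq_iff)
  have "\<eta> \<in> span (L ` T)" if "\<eta> \<in> forms 0 U" for \<eta> :: "'v list \<Rightarrow> 'u"
  proof -
    have "\<eta> = L (\<eta> [])"
      using forms_memD(2)[OF that] by (auto simp: L_def fun_eq_iff)
    moreover have "\<eta> [] \<in> span T"
      using forms_memD(1)[OF that] assms by auto
    ultimately show ?thesis
      using linear_span_image[OF lin] by (metis imageI)
  qed
  then show ?case using assms by blast
next
  case (Suc p)
  then obtain S where S: "finite S" "(forms p U :: ('v list \<Rightarrow> 'u) set) \<subseteq> span S" by blast
  define L where "L = (\<lambda>(e::'v) (\<zeta>::'v list \<Rightarrow> 'u) xs. case xs of [] \<Rightarrow> 0 | x # ys \<Rightarrow> (x \<bullet> e) *\<^sub>R \<zeta> ys)"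
  have lin: "linear (L e)" for e
    by (rule linearI) (auto simp: L_def fun_eq_iff scaleR_add_right split: list.split)
  have "\<eta> \<in> span (\<Union>e\<in>Basis. L e ` S)" if \<eta>: "\<eta> \<in> forms (Suc p) U" for \<eta> :: "'v list \<Rightarrow> 'u"
  proof -
    have "\<eta> = (\<Sum>e\<in>Basis. L e (contract e \<eta>))"
    proof
      fix xs show "\<eta> xs = (\<Sum>e\<in>Basis. L e (contract e \<eta>)) xs"
      proof (cases xs)
        case Nil
        then show ?thesis using forms_memD(2)[OF \<eta>] by (simp add: sum_fun_apply L_def)
      next
        case (Cons x ys)
        then show ?thesis
          using fun_cong[OF sum_contract_Basis[OF \<eta>, of x], of ys]
          by (simp add: sum_fun_apply L_def contract_def)
      qed
    qed
    moreover have "L e (contract e \<eta>) \<in> span (\<Union>e\<in>Basis. L e ` S)" if "e \<in> Basis" for e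
    proof -
      have "L e (contract e \<eta>) \<in> span (L e ` S)"
        using contract_in_forms[OF \<eta>] S(2) linear_span_image[OF lin] by blast
      then show ?thesis using that span_mono[of "L e ` S" "\<Union>e\<in>Basis. L e ` S"] by blast
    qed
    ultimately show ?thesis by (metis (no_types, lifting) span_sum)
  qed
  then show ?case using S(1) by (intro exI[of _ "\<Union>e\<in>Basis. L e ` S"]) auto
qed

section \<open>Exactness of the Koszul complex on smooth sections\<close>

lemma linear_functionals_separate:
  fixes w :: "'u::real_vector"
  assumes "\<And>l :: 'u \<Rightarrow> real. linear l \<Longrightarrow> l w = 0"
  shows "w = 0"
proof (rule ccontr)
  assume "w \<noteq> 0"
  then have "independent {w}" by (simp add: dependent_single)
  from linear_independent_extend[OF this, of "\<lambda>_. 1::real"]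
  show False using assms by fastforce
qed

text \<open>
  Since smoothness is tested by linear functionals on the ambient space, the coefficients with
  respect to a basis of \<open>W\<close> are smooth: extend the dual basis to the ambient space. This reduces
  the calculus of sections to that of real functions.
\<close>
lemma sections_finite_expansion:
  fixes W :: "'u::real_vector set"
  assumes W: "subspace W" "finite S" "W \<subseteq> span S" and f: "f \<in> sections W"
  obtains B c where "finite B" "B \<subseteq> W" "\<And>u. u \<in> B \<Longrightarrow> smooth (c u)"
    "\<And>q. f q = (\<Sum>u\<in>B. c u q *\<^sub>R u)"
proof -
  obtain B where B: "B \<subseteq> W" "independent B" "W \<subseteq> span B"
    by (rule maximal_independent_subset)
  have fin: "finite B"
    using independent_span_bound[OF W(2) B(2) order_trans[OF B(1) W(3)]] by simp
  have "\<exists>l :: 'u \<Rightarrow> real. linear l \<and> (\<forall>v\<in>B. l v = (if v = u then 1 else 0))" for u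
    by (rule linear_independent_extend[OF B(2)])
  then obtain l :: "'u \<Rightarrow> 'u \<Rightarrow> real" where
    l: "\<And>u. linear (l u)" "\<And>u v. v \<in> B \<Longrightarrow> l u v = (if v = u then 1 else 0)"
    by metis
  have expand: "w = (\<Sum>u\<in>B. l u w *\<^sub>R u)" if "w \<in> W" for w
  proof -
    have "w \<in> span B" using that B by auto
    then obtain a where a: "w = (\<Sum>u\<in>B. a u *\<^sub>R u)"
      using span_finite[OF fin] by auto
    have "l u w = a u" if "u \<in> B" for u
    proof -
      have "l u w = (\<Sum>v\<in>B. a v * l u v)"
        unfolding a by (simp add: linear_sum[OF l(1)] linear_cmul[OF l(1)])
      also have "\<dots> = (\<Sum>v\<in>B. if v = u then a v else 0)"
        by (intro sum.cong) (auto simp: l(2))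
      finally show ?thesis using fin that by simp
    qed
    then show ?thesis using a by simp
  qed
  show ?thesis
  proof (rule that[of B "\<lambda>u q. l u (f q)"])
    show "smooth (\<lambda>q. l u (f q))" for u
      using f l by (auto simp: sections_def)
    show "f q = (\<Sum>u\<in>B. l u (f q) *\<^sub>R u)" for q
      using f by (intro expand) (auto simp: sections_def)
  qed (use B fin in auto)
qed

lemma sections_sum_scale:
  assumes "subspace W" "\<And>i. i \<in> I \<Longrightarrow> smooth (c i)" "\<And>i. i \<in> I \<Longrightarrow> w i \<in> W"
  shows "(\<lambda>q. \<Sum>i\<in>I. c i q *\<^sub>R w i) \<in> sections W"
  using assms unfolding sections_def
  by (auto intro!: subspace_sum subspace_scale smooth_sum smooth_mult smooth_const
      simp: linear_sum linear_cmul)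

text \<open>
  The Poincare-type homotopy for the Euler vector field. By Cartan's formula
  \<open>\<iota>\<^sub>E d + d \<iota>\<^sub>E = L\<^sub>E\<close>, where \<open>d\<close> is for the moment the exterior derivative, and on the coefficients
  of a \<open>k\<close>-form \<open>L\<^sub>E\<close> acts as \<open>E + k\<close>. For \<open>k \<ge> 1\<close> this operator is inverted by the radial integral
  with exponent \<open>k - 1\<close>, which preserves the condition \<open>\<iota>\<^sub>E f = 0\<close>. Hence \<open>g = d (L\<^sub>E\<^sup>-\<^sup>1 f)\<close>
  satisfies \<open>\<iota>\<^sub>E g = f\<close>. In degree \<open>0\<close> the operator \<open>E\<close> is not invertible, and there
  exactness fails.
\<close>
lemma koszul_exact:
  fixes U :: "'u::real_vector set" and f :: "'v::euclidean_space \<Rightarrow> 'v list \<Rightarrow> 'u"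
  assumes U: "subspace U" "finite T" "U \<subseteq> span T"
    and f: "f \<in> sections (forms (Suc p) U)" and closed: "\<And>q. contract q (f q) = 0"
  obtains g where "g \<in> sections (forms (Suc (Suc p)) U)" "\<And>q. contract q (g q) = f q"
proof -
  obtain S where S: "finite S" "(forms (Suc p) U :: ('v list \<Rightarrow> 'u) set) \<subseteq> span S"
    using forms_finite_span[OF U(2,3)] by blast
  obtain B c where B: "finite B" "B \<subseteq> forms (Suc p) U"
    and c: "\<And>u. u \<in> B \<Longrightarrow> smooth (c u)" and fc: "\<And>q. f q = (\<Sum>u\<in>B. c u q *\<^sub>R u)"
    by (rule sections_finite_expansion[OF subspace_forms[OF U(1)] S f]) blast
  \<comment> \<open>The coefficients of \<open>L\<^sub>E\<^sup>-\<^sup>1 f\<close>, of their derivatives, and the exterior derivative itself.\<close>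
  define J where "J = (\<lambda>u. radial_integral p (c u))"
  define I where "I = (\<lambda>u e. radial_integral (Suc p) (\<lambda>x. frechet_derivative (c u) (at x) e))"
  define g where "g = (\<lambda>q. \<Sum>(u, e)\<in>B \<times> Basis. I u e q *\<^sub>R ext_mult e u)"
  have g_eq: "g q = (\<Sum>u\<in>B. \<Sum>e\<in>Basis. I u e q *\<^sub>R ext_mult e u)" for q
    by (simp add: g_def sum.cartesian_product)
  have Bf: "u \<in> forms (Suc p) U" if "u \<in> B" for u using B that by auto
  have "(\<lambda>q. \<Sum>i\<in>B \<times> Basis. (case i of (u, e) \<Rightarrow> I u e) q *\<^sub>R (case i of (u, e) \<Rightarrow> ext_mult e u))
      \<in> sections (forms (Suc (Suc p)) U)"
  proof (rule sections_sum_scale)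
    show "subspace (forms (Suc (Suc p)) U :: ('v list \<Rightarrow> 'u) set)"
      by (rule subspace_forms[OF U(1)])
    fix i :: "('v list \<Rightarrow> 'u) \<times> 'v" assume "i \<in> B \<times> Basis"
    then obtain u e where i: "i = (u, e)" "u \<in> B" by auto
    have "smooth (I u e)"
      unfolding I_def by (intro smooth_radial_integral smooth_frechet_derivative c i)
    then show "smooth (case i of (u, e) \<Rightarrow> I u e)" using i by simp
    have "ext_mult e u \<in> forms (Suc (Suc p)) U"
      by (intro ext_mult_in_forms U Bf i)
    then show "(case i of (u, e) \<Rightarrow> ext_mult e u) \<in> forms (Suc (Suc p)) U" using i by simp
  qed
  then have g: "g \<in> sections (forms (Suc (Suc p)) U)"
    by (simp add: g_def split_beta')
  \<comment> \<open>The hypothesis \<open>\<iota>\<^sub>q (f q) = 0\<close>, differentiated in direction \<open>e\<close> and integrated along the ray to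
    \<open>q\<close>. As the space of forms has no topology, this is checked after applying functionals.\<close>
  have rel: "(\<Sum>u\<in>B. I u e q *\<^sub>R contract q u) = - (\<Sum>u\<in>B. J u q *\<^sub>R contract e u)" for e q
  proof -
    have "(\<Sum>u\<in>B. I u e q *\<^sub>R contract q u) + (\<Sum>u\<in>B. J u q *\<^sub>R contract e u) = 0"
    proof (rule linear_functionals_separate)
      fix l :: "('v list \<Rightarrow> 'u) \<Rightarrow> real" assume l: "linear l"
      have "(\<Sum>u\<in>B. I u e q * l (contract q u)) = - (\<Sum>u\<in>B. J u q * l (contract e u))"
        unfolding I_def J_def
      proof (rule radial_integral_relation)
        show "linear (\<lambda>x. l (contract x u))" if "u \<in> B" for u
          using linear_compose[OF linear_contract_head[OF Bf[OF that]] l] by (simp add: o_def)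
        have "l (contract x (f x)) = (\<Sum>u\<in>B. c u x * l (contract x u))" for x
          by (simp add: fc linear_sum[OF linear_contract] linear_cmul[OF linear_contract]
              linear_sum[OF l] linear_cmul[OF l])
        then show "(\<Sum>u\<in>B. c u x * l (contract x u)) = 0" for x
          using closed linear_0[OF l] by metis
      qed (rule c)
      then show "l ((\<Sum>u\<in>B. I u e q *\<^sub>R contract q u) + (\<Sum>u\<in>B. J u q *\<^sub>R contract e u)) = 0"
        by (simp add: linear_add[OF l] linear_sum[OF l] linear_cmul[OF l])
    qed
    then show ?thesis by (simp add: eq_neg_iff_add_eq_0)
  qed
  have "contract q (g q) = f q" for q
  proof -
    have "contract q (g q) = (\<Sum>u\<in>B. (\<Sum>e\<in>Basis. (q \<bullet> e) * I u e q) *\<^sub>R u) -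
        (\<Sum>e\<in>Basis. ext_mult e (\<Sum>u\<in>B. I u e q *\<^sub>R contract q u))"
      unfolding g_eq
      by (simp add: linear_sum[OF linear_contract] linear_cmul[OF linear_contract]
          linear_sum[OF linear_ext_mult] linear_cmul[OF linear_ext_mult] contract_ext_mult
          scaleR_diff_right sum_subtractf scaleR_sum_left mult.commute sum.swap[of _ B Basis])
    also have "(\<Sum>u\<in>B. (\<Sum>e\<in>Basis. (q \<bullet> e) * I u e q) *\<^sub>R u) =
        f q - (\<Sum>u\<in>B. (Suc p * J u q) *\<^sub>R u)"
      unfolding I_def J_def fc
      by (simp add: radial_integral_euler[OF c] scaleR_diff_left sum_subtractf del: of_nat_Suc cong: sum.cong)
    also have "(\<Sum>e\<in>Basis. ext_mult e (\<Sum>u\<in>B. I u e q *\<^sub>R contract q u)) =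
        - (\<Sum>u\<in>B. J u q *\<^sub>R (\<Sum>e\<in>Basis. ext_mult e (contract e u)))"
      unfolding rel
      by (simp add: linear_neg[OF linear_ext_mult] linear_sum[OF linear_ext_mult]
          linear_cmul[OF linear_ext_mult] sum_negf scaleR_sum_right sum.swap[of _ B Basis])
    also have "\<dots> = - (\<Sum>u\<in>B. (Suc p * J u q) *\<^sub>R u)"
      by (simp add: sum_ext_mult_contract[OF Bf] mult.commute del: of_nat_Suc cong: sum.cong)
    finally show ?thesis by (simp only: diff_minus_eq_add diff_add_cancel)
  qed
  with g show ?thesis by (rule that)
qed

section \<open>Sections\<close>

lemma sections_mem: "f \<in> sections U \<Longrightarrow> f q \<in> U"
  by (simp add: sections_def)

lemma sections_linear_image:
  assumes "f \<in> sections U" "linear L" "\<And>u. u \<in> U \<Longrightarrow> L u \<in> U'"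
  shows "(\<lambda>q. L (f q)) \<in> sections U'"
proof -
  have "smooth (\<lambda>q. l (L (f q)))" if "linear l" for l
    using assms(1) linear_compose[OF assms(2) that] by (auto simp: sections_def o_def)
  then show ?thesis using assms by (auto simp: sections_def)
qed

lemma subspace_sections:
  fixes U :: "'u::real_vector set"
  assumes "subspace U" shows "subspace (sections U :: ('v::euclidean_space \<Rightarrow> 'u) set)"
  unfolding subspace_def
proof (intro conjI ballI allI)
  show "0 \<in> (sections U :: ('v \<Rightarrow> 'u) set)"
    using assms by (auto simp: sections_def subspace_0 linear_0 smooth_const)
  fix f g :: "'v \<Rightarrow> 'u" and c :: real assume f: "f \<in> sections U"
  show "c *\<^sub>R f \<in> sections U"
    using f assms by (auto simp: sections_def subspace_scale linear_cmul intro!: smooth_mult smooth_const)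
  assume g: "g \<in> sections U"
  show "f + g \<in> sections U"
    using f g assms by (auto simp: sections_def subspace_add linear_add intro!: smooth_add)
qed

lemma sections_contract:
  fixes f :: "'v::euclidean_space \<Rightarrow> 'v list \<Rightarrow> 'u::real_vector"
  assumes U: "subspace U" and f: "f \<in> sections (forms (Suc p) U)"
  shows "(\<lambda>q. contract q (f q)) \<in> sections (forms p U)"
proof -
  have mem: "f q \<in> forms (Suc p) U" for q
    using f by (rule sections_mem)
  have "smooth (\<lambda>q. l (contract q (f q)))" if l: "linear l" for l
  proof -
    have "l (contract q (f q)) = (\<Sum>e\<in>Basis. (q \<bullet> e) * l (contract e (f q)))" for q
      by (subst sum_contract_Basis[OF mem, symmetric]) (simp add: linear_sum[OF l] linear_cmul[OF l])
    moreover have "smooth (\<lambda>q. l (contract e (f q)))" for e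
      using f linear_compose[OF linear_contract l] by (auto simp: sections_def o_def)
    moreover have "smooth (\<lambda>q. q \<bullet> e)" for e :: 'v
      by (intro smooth_linear) (simp add: bounded_linear.linear bounded_linear_inner_left)
    ultimately show ?thesis
      by (simp add: smooth_sum smooth_mult)
  qed
  then show ?thesis
    using contract_in_forms[OF mem] by (simp add: sections_def)
qed

section \<open>Sections of a quotient\<close>

definition coset_section :: "'u::real_vector set \<Rightarrow> ('v \<Rightarrow> 'u) \<Rightarrow> 'v \<Rightarrow> 'u set"
  where "coset_section N f = (\<lambda>q. f q +o N)"

lemma coset_eq_iff:
  assumes "subspace N" shows "u +o N = v +o N \<longleftrightarrow> u - v \<in> N"
proof
  assume "u +o N = v +o N"
  moreover have "u \<in> u +o N"
    using set_plus_intro2[of 0 N u] subspace_0[OF assms] by simp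
  ultimately show "u - v \<in> N"
    by (simp add: set_minus_plus)
next
  have sub: "u +o N \<subseteq> v +o N" if "u - v \<in> N" for u v
  proof
    fix x assume "x \<in> u +o N"
    then have "(x - u) + (u - v) \<in> N"
      using that assms by (intro subspace_add) (auto simp: set_minus_plus)
    then show "x \<in> v +o N" by (simp add: set_minus_plus)
  qed
  assume "u - v \<in> N"
  then show "u +o N = v +o N"
    using sub[of u v] sub[of v u] subspace_neg[OF assms, of "u - v"] by auto
qed

lemma coset_section_eq_iff:
  "subspace N \<Longrightarrow> coset_section N f = coset_section N g \<longleftrightarrow> (\<forall>q. f q - g q \<in> N)"
  by (simp add: coset_section_def fun_eq_iff coset_eq_iff)

lemma coset_section_add:
  assumes "subspace N"
  shows "coset_section N f + coset_section N g = coset_section N (\<lambda>q. f q + g q)"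
proof -
  have "N + N = N"
    using subspace_add[OF assms] subspace_0[OF assms] by (auto simp: set_plus_def intro: bexI[of _ 0])
  then show ?thesis
    by (simp add: coset_section_def plus_fun_def set_plus_rearrange)
qed

lemma the_elem_coset:
  assumes "subspace N" "\<And>v. v \<in> N \<Longrightarrow> h (u + v) = h u"
  shows "the_elem (h ` (u +o N)) = h u"
proof (rule the_elem_image_unique)
  show "u +o N \<noteq> {}"
    using subspace_0[OF assms(1)] by (auto simp: elt_set_plus_def)
qed (use assms in \<open>auto simp: elt_set_plus_def\<close>)

text \<open>
  A projection with kernel \<open>N\<close>. It factors through the quotient by \<open>N\<close> and thus selects a
  representative in each coset, linearly.
\<close>
lemma splitting_exists:
  fixes N :: "'u::real_vector set"
  assumes "subspace N"
  shows "\<exists>\<sigma> :: 'u \<Rightarrow> 'u. linear \<sigma> \<and> (\<forall>u\<in>N. \<sigma> u = 0) \<and> (\<forall>u. \<sigma> u - u \<in> N)"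
proof -
  obtain B where B: "B \<subseteq> N" "independent B" "N \<subseteq> span B"
    by (rule maximal_independent_subset)
  obtain B' where B': "B \<subseteq> B'" "independent B'" "UNIV \<subseteq> span B'"
    using maximal_independent_subset_extend[OF subset_UNIV B(2)] by metis
  obtain \<sigma> :: "'u \<Rightarrow> 'u" where \<sigma>: "linear \<sigma>" "\<forall>x\<in>B'. \<sigma> x = (if x \<in> B then 0 else x)"
    using linear_independent_extend[OF B'(2), of "\<lambda>x. if x \<in> B then 0 else x"] by auto
  have "\<sigma> x = 0" if "x \<in> B" for x
    using \<sigma>(2) B'(1) that by auto
  then have "\<sigma> u = 0" if "u \<in> N" for u
    using linear_eq_0_on_span[OF \<sigma>(1)] B(3) that by blast
  moreover have "\<sigma> u - u \<in> N" for u
  proof -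
    have "u \<in> span B'" using B' by auto
    then show ?thesis
    proof (induction rule: span_induct_alt)
      case base
      then show ?case using \<sigma> assms by (simp add: linear_0 subspace_0)
    next
      case (step c x y)
      have "\<sigma> x - x \<in> N"
        using \<sigma>(2) B(1) step(1) subspace_neg[OF assms] subspace_0[OF assms] by auto
      then have "c *\<^sub>R (\<sigma> x - x) + (\<sigma> y - y) \<in> N"
        using step assms by (intro subspace_add subspace_scale)
      then show ?case
        by (simp add: linear_add[OF \<sigma>(1)] linear_cmul[OF \<sigma>(1)] algebra_simps)
    qed
  qed
  ultimately show ?thesis using \<sigma>(1) by blast
qed

text \<open>
  A section of the quotient is smooth when all functionals killing \<open>N\<close> make it smooth. Composing
  a linear splitting \<open>\<sigma>\<close> of the quotient with an arbitrary functional gives such a functional, so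
  \<open>\<sigma>\<close> turns smooth sections of the quotient into smooth sections of \<open>U\<close>.
\<close>
lemma quotient_sections_eq:
  assumes U: "subspace U" and N: "subspace N" and "N \<subseteq> U"
  shows "quotient_sections U N = coset_section N ` sections U"
proof (intro equalityI subsetI)
  fix F assume "F \<in> coset_section N ` sections U"
  then obtain f where f: "f \<in> sections U" "F = coset_section N f" by auto
  have "the_elem (l ` (f q +o N)) = l (f q)" if "linear l" "\<forall>u\<in>N. l u = 0" for l :: "'a \<Rightarrow> real" and q
    using that by (intro the_elem_coset[OF N]) (simp add: linear_add)
  then show "F \<in> quotient_sections U N"
    using f by (auto simp: quotient_sections_def coset_section_def quotient_space_def sections_def)
next
  fix F assume F: "F \<in> quotient_sections U N"
  obtain \<sigma> :: "'a \<Rightarrow> 'a" where \<sigma>: "linear \<sigma>" "\<forall>u\<in>N. \<sigma> u = 0" "\<forall>u. \<sigma> u - u \<in> N"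
    using splitting_exists[OF N] by blast
  have "\<forall>q. \<exists>u\<in>U. F q = u +o N"
    using F by (auto simp: quotient_sections_def quotient_space_def image_iff)
  then obtain u where u: "\<And>q. u q \<in> U" "\<And>q. F q = u q +o N" by metis
  have "smooth (\<lambda>q. l (\<sigma> (u q)))" if l: "linear l" for l
  proof -
    have "linear (\<lambda>w. l (\<sigma> w))"
      using linear_compose[OF \<sigma>(1) l] by (simp add: o_def)
    moreover have "\<forall>w\<in>N. l (\<sigma> w) = 0"
      using \<sigma>(2) linear_0[OF l] by simp
    ultimately have "smooth (\<lambda>q. the_elem ((\<lambda>w. l (\<sigma> w)) ` F q))"
      using F by (simp add: quotient_sections_def)
    moreover have "the_elem ((\<lambda>w. l (\<sigma> w)) ` F q) = l (\<sigma> (u q))" for q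
      unfolding u(2) using \<sigma>(2) by (intro the_elem_coset[OF N]) (simp add: linear_add[OF \<sigma>(1)])
    ultimately show ?thesis by simp
  qed
  moreover have "\<sigma> (u q) \<in> U" for q
  proof -
    have "(\<sigma> (u q) - u q) + u q \<in> U"
      using \<sigma>(3) u(1) \<open>N \<subseteq> U\<close> U by (intro subspace_add) auto
    then show ?thesis by simp
  qed
  ultimately have "(\<lambda>q. \<sigma> (u q)) \<in> sections U"
    by (simp add: sections_def)
  moreover have "F = coset_section N (\<lambda>q. \<sigma> (u q))"
  proof
    fix q show "F q = coset_section N (\<lambda>q. \<sigma> (u q)) q"
      using \<sigma>(3) subspace_neg[OF N, of "\<sigma> (u q) - u q"]
      by (simp add: u(2) coset_section_def coset_eq_iff[OF N])
  qed
  ultimately show "F \<in> coset_section N ` sections U" by blast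
qed

section \<open>The bundle maps \<open>\<phi>\<^sup>\<omega>_i\<close>\<close>

lemma subspace_two_forms: "subspace two_forms"
proof -
  have "linear (\<lambda>x. c * f x)" if "linear f" for f :: "'a \<Rightarrow> real" and c
    using linear_compose_scale_right[OF that, of c] by simp
  then show ?thesis
    by (auto simp: subspace_def two_forms_def bilinear_def linear_zero zero_fun_def plus_fun_def
        scaleR_fun_def intro: linear_compose_add)
qed

lemma two_forms_finite_span:
  "\<exists>T. finite T \<and> (two_forms :: ('v::euclidean_space \<Rightarrow> 'v \<Rightarrow> real) set) \<subseteq> span T"
proof (intro exI conjI subsetI)
  let ?w = "\<lambda>(b, c). wedge (\<lambda>x::'v. x \<bullet> b) (\<lambda>x. x \<bullet> c)"
  show "finite (?w ` (Basis \<times> Basis))" by simp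
  fix B :: "'v \<Rightarrow> 'v \<Rightarrow> real" assume "B \<in> two_forms"
  show "B \<in> span (?w ` (Basis \<times> Basis))"
    by (subst two_forms_decompose[OF \<open>B \<in> two_forms\<close>])
       (intro span_sum span_scale span_base, force)
qed

lemma two_forms_antisym:
  assumes "B \<in> two_forms" shows "B y x = - B x y"
proof -
  have bil: "bilinear B" and alt: "B z z = 0" for z
    using assms by (auto simp: two_forms_def)
  have "B (x + y) (x + y) = B x x + B x y + B y x + B y y"
    using bil by (simp add: bilinear_ladd bilinear_radd)
  then show ?thesis using alt by simp
qed

lemma two_forms_linear:
  assumes "B \<in> two_forms" shows "linear (\<lambda>x. B x y)" "linear (\<lambda>y. B x y)"
  using assms by (auto simp: two_forms_def bilinear_def)

lemma symplectic_two_form: "symplectic_form \<omega> \<Longrightarrow> \<omega> \<in> two_forms"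
  by (simp add: symplectic_form_def)

lemma phi_apply:
  assumes \<omega>: "\<omega> \<in> two_forms" and \<eta>: "\<eta> \<in> forms i UNIV"
  shows "phi \<omega> i \<eta> xs y z = (-1) ^ (i - 1) * (\<omega> (\<eta> (y # xs)) z - \<omega> (\<eta> (z # xs)) y)"
proof -
  have *: "(\<Sum>e\<in>Basis. (y \<bullet> e) * \<omega> (\<eta> (e # xs)) z) = \<omega> (\<eta> (y # xs)) z" for y z
  proof -
    have lin: "linear (\<lambda>v. \<omega> (\<eta> (v # xs)) z)"
      using linear_compose[OF form_linear_head[OF \<eta>] two_forms_linear(1)[OF \<omega>]] by (simp add: o_def)
    have "\<omega> (\<eta> (y # xs)) z = \<omega> (\<eta> ((\<Sum>e\<in>Basis. (y \<bullet> e) *\<^sub>R e) # xs)) z"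
      by (simp add: euclidean_representation)
    also have "\<dots> = (\<Sum>e\<in>Basis. (y \<bullet> e) * \<omega> (\<eta> (e # xs)) z)"
      by (subst linear_sum[OF lin]) (simp add: linear_cmul[OF lin])
    finally show ?thesis ..
  qed
  show ?thesis
    by (simp add: phi_def sum_fun_apply wedge_def contract_def sum_subtractf *)
qed

lemma linear_phi:
  assumes "\<omega> \<in> two_forms" shows "linear (phi \<omega> i)"
  by (rule linearI)
     (auto simp: phi_def fun_eq_iff sum_fun_apply wedge_def contract_def
       linear_add[OF two_forms_linear(1)[OF assms]] linear_cmul[OF two_forms_linear(1)[OF assms]]
       sum.distrib[symmetric] sum_distrib_left algebra_simps)

lemma phi_in_forms:
  assumes \<omega>: "\<omega> \<in> two_forms" and \<eta>: "\<eta> \<in> forms (Suc p) UNIV"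
  shows "phi \<omega> (Suc p) \<eta> \<in> forms p two_forms"
proof -
  note app = phi_apply[OF \<omega> \<eta>]
  note lin\<omega> = two_forms_linear[OF \<omega>]
  have mem: "phi \<omega> (Suc p) \<eta> xs \<in> two_forms" for xs
  proof -
    have "linear (\<lambda>y. \<omega> (\<eta> (y # xs)) z)" for z
      using linear_compose[OF form_linear_head[OF \<eta>] lin\<omega>(1)] by (simp add: o_def)
    then have "bilinear (\<lambda>y z. (-1) ^ p * (\<omega> (\<eta> (y # xs)) z - \<omega> (\<eta> (z # xs)) y))"
      unfolding bilinear_def using lin\<omega>(2) linear_compose_scale_right[of _ "(-1) ^ p :: real"]
      by (auto intro!: linear_compose_sub simp: real_scaleR_def[symmetric] simp del: real_scaleR_def)
    moreover have "phi \<omega> (Suc p) \<eta> xs = (\<lambda>y z. (-1) ^ p * (\<omega> (\<eta> (y # xs)) z - \<omega> (\<eta> (z # xs)) y))"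
      by (auto simp: app fun_eq_iff)
    ultimately show ?thesis by (simp add: two_forms_def)
  qed
  have lin: "linear (\<lambda>v. phi \<omega> (Suc p) \<eta> (xs[i := v]))" if "length xs = p" "i < p" for xs i
  proof -
    have "linear (\<lambda>v. \<eta> (y # xs[i := v]))" for y
      using forms_memD(3)[OF \<eta>, of "y # xs" "Suc i"] that by simp
    note l = linear_add[OF this] linear_cmul[OF this] linear_add[OF lin\<omega>(1)] linear_cmul[OF lin\<omega>(1)]
    show ?thesis
      by (rule linearI) (auto simp: fun_eq_iff app l algebra_simps)
  qed
  have zero: "phi \<omega> (Suc p) \<eta> xs = 0" if "\<And>y. \<eta> (y # xs) = 0" for xs
    using that linear_0[OF lin\<omega>(1)] by (auto simp: fun_eq_iff app)
  have "phi \<omega> (Suc p) \<eta> xs = 0" if "length xs \<noteq> p" for xs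
    by (rule zero, rule forms_memD(2)[OF \<eta>]) (use that in simp)
  moreover have "phi \<omega> (Suc p) \<eta> xs = 0" if "\<not> distinct xs" for xs
    by (rule zero, rule forms_memD(4)[OF \<eta>]) (use that in simp)
  ultimately show ?thesis
    using mem lin by (simp add: forms_def)
qed

text \<open>
  The alternating sign in \<open>\<phi>\<^sup>\<omega>_i\<close> compensates for the interchange of the inserted vector \<open>q\<close> with the
  vector that \<open>\<phi>\<^sup>\<omega>_i\<close> inserts. With \<open>d = \<iota>\<^sub>q\<close> and \<open>\<partial> = - \<iota>\<^sub>q\<close> this is the relation
  \<open>\<phi>\<^sup>\<omega>_p d_(p+1) + \<partial>_p \<phi>\<^sup>\<omega>_(p+1) = 0\<close>.
\<close>
lemma phi_contract:
  assumes \<omega>: "\<omega> \<in> two_forms" and \<eta>: "\<eta> \<in> forms (Suc (Suc p)) UNIV"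
  shows "phi \<omega> (Suc p) (contract q \<eta>) = contract q (phi \<omega> (Suc (Suc p)) \<eta>)"
proof (intro ext)
  fix xs y z
  have "\<eta> (q # y # xs) = - \<eta> (y # q # xs)" for y
    using fun_cong[OF contract_anticommute[OF \<eta>, of y q], of xs] by (simp add: contract_def)
  then show "phi \<omega> (Suc p) (contract q \<eta>) xs y z = contract q (phi \<omega> (Suc (Suc p)) \<eta>) xs y z"
    unfolding phi_apply[OF \<omega> contract_in_forms[OF \<eta>]]
    by (simp add: contract_def phi_apply[OF \<omega> \<eta>] linear_neg[OF two_forms_linear(1)[OF \<omega>]] algebra_simps)
qed

text \<open>
  With the vector value turned into a covector by \<open>\<omega>\<close>, an element of the kernel is a tensor
  \<open>T(x,y,z)\<close> antisymmetric in its first two arguments and symmetric in the first and the last. Such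
  a tensor is zero. At least two form arguments are needed: for \<open>i = 1\<close> the kernel is the
  symplectic Lie algebra.
\<close>
lemma phi_injective:
  assumes \<omega>: "symplectic_form \<omega>" and \<eta>: "\<eta> \<in> forms (Suc (Suc p)) UNIV"
    and 0: "phi \<omega> (Suc (Suc p)) \<eta> = 0"
  shows "\<eta> = 0"
proof
  fix xs
  note \<omega>2 = symplectic_two_form[OF \<omega>]
  have "\<omega> (\<eta> (x # y # ys)) z = 0" for x y z ys
  proof -
    define T where "T = (\<lambda>x y z. \<omega> (\<eta> (x # y # ys)) z)"
    have sym: "T y x z = T z x y" for x y z
      using fun_cong[OF fun_cong[OF fun_cong[OF 0, of "x # ys"], of y], of z]
      by (simp add: phi_apply[OF \<omega>2 \<eta>] T_def)
    have anti: "T x y z = - T y x z" for x y z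
      using fun_cong[OF contract_anticommute[OF \<eta>, of y x], of ys]
      by (simp add: contract_def T_def linear_neg[OF two_forms_linear(1)[OF \<omega>2]])
    have "T x y z = - T x y z"
      using sym anti by metis
    then show ?thesis by (simp add: T_def)
  qed
  then have "\<eta> (x # y # ys) = 0" for x y ys
    using \<omega> by (auto simp: symplectic_form_def)
  moreover have "\<eta> [] = 0" "\<eta> [x] = 0" for x
    using forms_memD(2)[OF \<eta>] by auto
  ultimately show "\<eta> xs = 0 xs"
    by (metis list.exhaust zero_fun_apply)
qed

lemma symplectic_sharp:
  assumes "symplectic_form \<omega>"
  obtains R where "linear R" "\<And>u y. \<omega> (R u) y = u \<bullet> y"
proof -
  note lin = two_forms_linear[OF symplectic_two_form[OF assms]]
  define J where "J = (\<lambda>x. \<Sum>e\<in>Basis. \<omega> x e *\<^sub>R e)"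
  have linJ: "linear J"
    unfolding J_def
    by (rule linearI)
       (simp_all add: linear_add[OF lin(1)] linear_cmul[OF lin(1)] scaleR_add_left sum.distrib scaleR_sum_right)
  have J: "J x \<bullet> y = \<omega> x y" for x y
  proof -
    have "\<omega> x y = \<omega> x (\<Sum>e\<in>Basis. (y \<bullet> e) *\<^sub>R e)" by (simp add: euclidean_representation)
    also have "\<dots> = (\<Sum>e\<in>Basis. (y \<bullet> e) * \<omega> x e)"
      by (simp add: linear_sum[OF lin(2)] linear_cmul[OF lin(2)])
    finally show ?thesis
      by (simp add: J_def inner_sum_left inner_commute[of y] mult.commute)
  qed
  have "x = 0" if "J x = 0" for x
    using assms J[of x] that by (auto simp: symplectic_form_def)
  then have "inj J"
    using linear_injective_0[OF linJ] by blast
  from linear_injective_isomorphism[OF linJ this]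
  obtain R where "linear R" "\<forall>x. J (R x) = x" by blast
  then show ?thesis
    using J that by metis
qed

text \<open>
  The classical argument for the existence of a torsion-free metric connection: a tensor \<open>T(x,y,z)\<close>
  antisymmetric in \<open>x, y\<close> is determined by \<open>B(x;y,z) = T(x,y,z) - T(x,z,y)\<close> through
  \<open>2 T(x,y,z) = B(x;y,z) - B(y;x,z) - B(z;x,y)\<close>.
\<close>
lemma phi2_surjective:
  assumes \<omega>: "symplectic_form \<omega>" and B: "B \<in> forms (Suc 0) two_forms"
  shows "\<exists>\<eta>\<in>forms 2 UNIV. phi \<omega> 2 \<eta> = B"
proof -
  note \<omega>2 = symplectic_two_form[OF \<omega>]
  obtain R where R: "linear R" "\<And>u y. \<omega> (R u) y = u \<bullet> y"
    by (rule symplectic_sharp[OF \<omega>]) blast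
  define T where "T = (\<lambda>x y z. (B [x] y z - B [y] x z - B [z] x y) / 2)"
  have B2: "B [x] \<in> two_forms" for x
    by (rule forms_memD(1)[OF B])
  note lin = form_linear_head[OF B, of "[]"] two_forms_linear[OF B2]
  note lin_simps = linear_add[OF lin(1)] linear_cmul[OF lin(1)] linear_add[OF lin(2)]
    linear_cmul[OF lin(2)] linear_add[OF lin(3)] linear_cmul[OF lin(3)]
  have Tadd: "T (x + x') y z = T x y z + T x' y z" "T x (y + y') z = T x y z + T x y' z"
    "T x y (z + z') = T x y z + T x y z'" for x x' y y' z z'
    by (simp_all add: T_def lin_simps field_simps)
  have Tscale: "T (c *\<^sub>R x) y z = c * T x y z" "T x (c *\<^sub>R y) z = c * T x y z"
    "T x y (c *\<^sub>R z) = c * T x y z" for c x y z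
    by (simp_all add: T_def lin_simps field_simps)
  have T0: "T x x z = 0" for x z
    using B2[of z] by (simp add: T_def two_forms_def)
  define S where "S = (\<lambda>x y. R (\<Sum>e\<in>Basis. T x y e *\<^sub>R e))"
  have S: "\<omega> (S x y) z = T x y z" for x y z
  proof -
    have linT: "linear (T x y)"
      by (rule linearI) (simp_all add: Tadd Tscale)
    have "T x y z = T x y (\<Sum>e\<in>Basis. (z \<bullet> e) *\<^sub>R e)" by (simp add: euclidean_representation)
    also have "\<dots> = (\<Sum>e\<in>Basis. (z \<bullet> e) * T x y e)"
      by (simp add: linear_sum[OF linT] linear_cmul[OF linT])
    finally show ?thesis
      by (simp add: S_def R inner_sum_left inner_commute[of z] mult.commute)
  qed
  have linS: "linear (\<lambda>x. S x y)" "linear (\<lambda>y. S x y)" for x y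
    unfolding S_def
    by (rule linearI; simp add: Tadd Tscale scaleR_add_left sum.distrib linear_add[OF R(1)]
        linear_cmul[OF R(1), symmetric] scaleR_sum_right)+
  define \<eta> where "\<eta> = (\<lambda>xs. if length xs = 2 then S (xs ! 0) (xs ! 1) else 0)"
  have \<eta>_app: "\<eta> [x, y] = S x y" for x y
    by (simp add: \<eta>_def)
  have "\<eta> \<in> forms 2 UNIV"
  proof -
    have "linear (\<lambda>v. \<eta> (xs[i := v]))" if "length xs = 2" "i < 2" for xs i
    proof -
      have "i = 0 \<or> i = 1" using that by auto
      then show ?thesis
        using that linS by (auto simp: \<eta>_def)
    qed
    moreover have "\<eta> xs = 0" if "length xs = 2" "\<not> distinct xs" for xs
    proof -
      obtain x y where xs: "xs = [x, y]"
        using \<open>length xs = 2\<close> by (cases xs; cases "tl xs") auto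
      with that have "x = y" by simp
      have "S x x = 0" unfolding S_def by (simp add: T0 linear_0[OF R(1)])
      then show ?thesis using \<open>x = y\<close> xs by (simp add: \<eta>_app)
    qed
    ultimately show ?thesis by (auto simp: forms_def \<eta>_def)
  qed
  moreover have "phi \<omega> 2 \<eta> = B"
  proof (intro ext)
    fix xs y z
    have mem: "phi \<omega> 2 \<eta> \<in> forms (Suc 0) two_forms"
      using phi_in_forms[OF \<omega>2, of \<eta> "Suc 0"] \<open>\<eta> \<in> forms 2 UNIV\<close> by (simp add: numeral_2_eq_2)
    show "phi \<omega> 2 \<eta> xs y z = B xs y z"
    proof (cases "length xs = Suc 0")
      case True
      then obtain x where "xs = [x]" by (cases xs) auto
      then show ?thesis
        using two_forms_antisym[OF B2, of x y z] two_forms_antisym[OF B2, of z x y]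
          two_forms_antisym[OF B2, of y x z] two_forms_antisym[OF B2, of x z y]
        by (simp add: phi_apply[OF \<omega>2 \<open>\<eta> \<in> forms 2 UNIV\<close>] \<eta>_app S T_def field_simps)
    next
      case False
      then show ?thesis
        using forms_memD(2)[OF mem False] forms_memD(2)[OF B False] by simp
    qed
  qed
  ultimately show ?thesis by blast
qed

lemma phi1_eq_0_iff:
  assumes \<omega>: "\<omega> \<in> two_forms" and \<eta>: "\<eta> \<in> forms (Suc 0) UNIV"
  shows "phi \<omega> (Suc 0) \<eta> = 0 \<longleftrightarrow> (\<lambda>x. \<eta> [x]) \<in> sp \<omega>"
proof -
  have "phi \<omega> (Suc 0) \<eta> [] y z = \<omega> (\<eta> [y]) z + \<omega> y (\<eta> [z])" for y z
    using two_forms_antisym[OF \<omega>, of y "\<eta> [z]"] by (simp add: phi_apply[OF \<omega> \<eta>])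
  moreover have "phi \<omega> (Suc 0) \<eta> = 0 \<longleftrightarrow> (\<forall>y z. phi \<omega> (Suc 0) \<eta> [] y z = 0)"
  proof
    assume *: "\<forall>y z. phi \<omega> (Suc 0) \<eta> [] y z = 0"
    show "phi \<omega> (Suc 0) \<eta> = 0"
    proof
      fix xs show "phi \<omega> (Suc 0) \<eta> xs = 0 xs"
        using * forms_memD(2)[OF phi_in_forms[OF \<omega> \<eta>], of xs] by (cases "xs = []") (auto simp: fun_eq_iff)
    qed
  qed simp
  ultimately show ?thesis
    using form_linear_head[OF \<eta>] by (simp add: sp_def)
qed

text \<open>
  A pointwise preimage under the injective \<open>\<phi>\<^sup>\<omega>_i\<close> depends smoothly on the point because it is
  given by a fixed linear left inverse.
\<close>
lemma lift_section_through_phi: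
  assumes \<omega>: "symplectic_form \<omega>" and \<tau>: "\<tau> \<in> sections W"
    and im: "\<And>q. \<tau> q \<in> im_phi \<omega> (Suc (Suc p))"
  obtains a where "a \<in> sections (forms (Suc (Suc p)) UNIV)"
    "\<And>q. phi \<omega> (Suc (Suc p)) (a q) = \<tau> q"
proof -
  let ?\<phi> = "phi \<omega> (Suc (Suc p))" and ?F = "forms (Suc (Suc p)) UNIV"
  note lin = linear_phi[OF symplectic_two_form[OF \<omega>]]
  have sub: "subspace ?F" by (rule subspace_forms) simp
  have "inj_on ?\<phi> ?F"
    unfolding linear_inj_on_iff_eq_0[OF lin sub] using phi_injective[OF \<omega>] by blast
  then obtain P where P: "linear P" "\<forall>v\<in>?F. P (?\<phi> v) = v"
    using linear_exists_left_inverse_on[OF lin sub] by blast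
  show ?thesis
  proof (rule that)
    have "\<tau> \<in> sections (?\<phi> ` ?F)"
      using \<tau> im by (auto simp: sections_def im_phi_def)
    then show "(\<lambda>q. P (\<tau> q)) \<in> sections ?F"
      by (rule sections_linear_image[OF _ P(1)]) (use P in auto)
    show "?\<phi> (P (\<tau> q)) = \<tau> q" for q
      using im[of q] P(2) by (auto simp: im_phi_def)
  qed
qed

section \<open>The sequence of cokernels\<close>

lemma subspace_im_phi:
  assumes "\<omega> \<in> two_forms" shows "subspace (im_phi \<omega> i)"
  unfolding im_phi_def
  by (intro linear_subspace_image linear_phi assms subspace_forms subspace_UNIV)

lemma \<Gamma>C_eq:
  assumes "\<omega> \<in> two_forms"
  shows "\<Gamma>C \<omega> (Suc p) = coset_section (im_phi \<omega> (Suc p)) ` sections (forms p two_forms)"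
proof -
  have "im_phi \<omega> (Suc p) \<subseteq> forms p two_forms"
    using phi_in_forms[OF assms] by (auto simp: im_phi_def)
  then show ?thesis
    unfolding \<Gamma>C_def using quotient_sections_eq subspace_forms[OF subspace_two_forms] subspace_im_phi[OF assms]
    by (metis diff_Suc_1)
qed

lemma zeroC_eq: "zeroC \<omega> i = coset_section (im_phi \<omega> i) (\<lambda>q. 0)"
  by (simp add: zeroC_def coset_section_def)

lemma d_eq_contract: "\<eta> \<in> forms p UNIV \<Longrightarrow> d q \<eta> = contract q \<eta>"
  by (simp add: d_def sum_contract_Basis)

lemma del_eq_contract: "\<eta> \<in> forms p two_forms \<Longrightarrow> del q \<eta> = - contract q \<eta>"
  by (simp add: del_def sum_contract_Basis)

lemma contract_im_phi:
  assumes "\<omega> \<in> two_forms" "v \<in> im_phi \<omega> (Suc (Suc p))"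
  shows "contract q v \<in> im_phi \<omega> (Suc p)"
proof -
  obtain m where m: "m \<in> forms (Suc (Suc p)) UNIV" "v = phi \<omega> (Suc (Suc p)) m"
    using assms(2) by (auto simp: im_phi_def)
  then have "contract q v = phi \<omega> (Suc p) (contract q m)"
    by (simp add: phi_contract[OF assms(1)])
  then show ?thesis
    using contract_in_forms[OF m(1)] by (auto simp: im_phi_def)
qed

text \<open>
  \<open>\<iota>\<^sub>q\<close> maps the image of one \<open>\<phi>\<^sup>\<omega>_i\<close> into that of the preceding one, so the induced map can be
  computed on any representative.
\<close>
lemma del_bar_coset_section:
  assumes \<omega>: "\<omega> \<in> two_forms" and b: "b \<in> sections (forms (Suc p) two_forms)"
  shows "del_bar \<omega> (Suc p) (coset_section (im_phi \<omega> (Suc (Suc p))) b) =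
    coset_section (im_phi \<omega> (Suc p)) (\<lambda>q. - contract q (b q))"
proof
  fix q
  let ?N = "im_phi \<omega> (Suc (Suc p))" and ?N' = "im_phi \<omega> (Suc p)"
  have bq: "b q \<in> forms (Suc p) two_forms"
    using b by (rule sections_mem)
  have "del q (b q + v) +o ?N' = del q (b q) +o ?N'" if v: "v \<in> ?N" for v
  proof -
    have vf: "v \<in> forms (Suc p) two_forms"
      using v phi_in_forms[OF \<omega>] by (auto simp: im_phi_def)
    then have "b q + v \<in> forms (Suc p) two_forms"
      using bq by (intro subspace_add subspace_forms subspace_two_forms)
    then have "del q (b q + v) - del q (b q) = - contract q v"
      using bq by (simp add: del_eq_contract linear_add[OF linear_contract])
    then show ?thesis
      using contract_im_phi[OF \<omega> v] by (simp add: coset_eq_iff subspace_im_phi[OF \<omega>] subspace_neg)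
  qed
  then have "the_elem ((\<lambda>\<eta>. del q \<eta> +o ?N') ` (b q +o ?N)) = del q (b q) +o ?N'"
    by (intro the_elem_coset subspace_im_phi[OF \<omega>])
  then show "del_bar \<omega> (Suc p) (coset_section ?N b) q = coset_section ?N' (\<lambda>q. - contract q (b q)) q"
    by (simp add: del_bar_def coset_section_def del_eq_contract[OF bq])
qed

lemma sections_neg: "subspace U \<Longrightarrow> f \<in> sections U \<Longrightarrow> (\<lambda>q. - f q) \<in> sections U"
  using subspace_neg[OF subspace_sections, of U f] by (simp add: fun_Compl_def)

lemma sections_add: "subspace U \<Longrightarrow> f \<in> sections U \<Longrightarrow> g \<in> sections U \<Longrightarrow> (\<lambda>q. f q + g q) \<in> sections U"
  using subspace_add[OF subspace_sections, of U f g] by (simp add: plus_fun_def)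

lemma additive_del_bar:
  assumes \<omega>: "\<omega> \<in> two_forms"
  shows "additive_map (\<Gamma>C \<omega> (Suc (Suc p))) (del_bar \<omega> (Suc p)) (\<Gamma>C \<omega> (Suc p))"
  unfolding additive_map_def
proof (intro conjI subsetI ballI)
  note subf = subspace_forms[OF subspace_two_forms]
  fix G assume "G \<in> del_bar \<omega> (Suc p) ` \<Gamma>C \<omega> (Suc (Suc p))"
  then obtain b where b: "b \<in> sections (forms (Suc p) two_forms)"
    "G = coset_section (im_phi \<omega> (Suc p)) (\<lambda>q. - contract q (b q))"
    by (auto simp: \<Gamma>C_eq[OF \<omega>] del_bar_coset_section[OF \<omega>])
  show "G \<in> \<Gamma>C \<omega> (Suc p)"
    unfolding \<Gamma>C_eq[OF \<omega>] b(2)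
    by (rule imageI[OF sections_neg[OF subf sections_contract[OF subspace_two_forms b(1)]]])
next
  note subf = subspace_forms[OF subspace_two_forms]
  fix F G assume "F \<in> \<Gamma>C \<omega> (Suc (Suc p))" "G \<in> \<Gamma>C \<omega> (Suc (Suc p))"
  then obtain f g where f: "f \<in> sections (forms (Suc p) two_forms)" "F = coset_section (im_phi \<omega> (Suc (Suc p))) f"
    and g: "g \<in> sections (forms (Suc p) two_forms)" "G = coset_section (im_phi \<omega> (Suc (Suc p))) g"
    by (auto simp: \<Gamma>C_eq[OF \<omega>])
  show "del_bar \<omega> (Suc p) (F + G) = del_bar \<omega> (Suc p) F + del_bar \<omega> (Suc p) G"
    using f g sections_add[OF subf f(1) g(1)]
    by (simp add: coset_section_add[OF subspace_im_phi[OF \<omega>]] del_bar_coset_section[OF \<omega>]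
        linear_add[OF linear_contract])
qed

text \<open>
  Up to the sign, which does not affect the image, the induced map is contraction with \<open>q\<close>.
\<close>
lemma image_del_bar:
  assumes \<omega>: "\<omega> \<in> two_forms"
  shows "del_bar \<omega> (Suc p) ` \<Gamma>C \<omega> (Suc (Suc p)) =
    (\<lambda>b. coset_section (im_phi \<omega> (Suc p)) (\<lambda>q. contract q (b q))) ` sections (forms (Suc p) two_forms)"
    (is "?L = ?g ` ?S")
proof (intro equalityI subsetI)
  note subf = subspace_forms[OF subspace_two_forms]
  fix G assume "G \<in> ?L"
  then obtain b where b: "b \<in> ?S" "G = coset_section (im_phi \<omega> (Suc p)) (\<lambda>q. - contract q (b q))"
    by (auto simp: \<Gamma>C_eq[OF \<omega>] del_bar_coset_section[OF \<omega>])
  show "G \<in> ?g ` ?S"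
  proof (rule image_eqI)
    show "G = ?g (\<lambda>q. - b q)"
      using b(2) by (simp add: linear_neg[OF linear_contract])
    show "(\<lambda>q. - b q) \<in> ?S"
      by (rule sections_neg[OF subf b(1)])
  qed
next
  note subf = subspace_forms[OF subspace_two_forms]
  fix G assume "G \<in> ?g ` ?S"
  then obtain b where b: "b \<in> ?S" "G = ?g b" by auto
  then have "G = del_bar \<omega> (Suc p) (coset_section (im_phi \<omega> (Suc (Suc p))) (\<lambda>q. - b q))"
    using sections_neg[OF subf b(1)] by (simp add: del_bar_coset_section[OF \<omega>] linear_neg[OF linear_contract])
  then show "G \<in> ?L"
    using sections_neg[OF subf b(1)] by (auto simp: \<Gamma>C_eq[OF \<omega>])
qed

text \<open>
  The left end of the sequence: with \<open>p\<close> at least the dimension there are no nonzero \<open>(p+1)\<close>-forms.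
  The zero term can thus be replaced by one more cokernel, and injectivity of the first map
  becomes an instance of exactness in the middle.
\<close>
lemma image_del_bar_above_dim:
  fixes \<omega> :: "'v::euclidean_space \<Rightarrow> 'v \<Rightarrow> real"
  assumes \<omega>: "\<omega> \<in> two_forms" and p: "DIM('v) \<le> p"
  shows "del_bar \<omega> (Suc p) ` \<Gamma>C \<omega> (Suc (Suc p)) = {zeroC \<omega> (Suc p)}"
proof -
  have "b q = 0" if "b \<in> sections (forms (Suc p) two_forms)" for b :: "'v \<Rightarrow> 'v list \<Rightarrow> 'v \<Rightarrow> 'v \<Rightarrow> real" and q
    using forms_above_dim[OF sections_mem[OF that]] p by simp
  then have "(\<lambda>b. coset_section (im_phi \<omega> (Suc p)) (\<lambda>q. contract q (b q))) b = zeroC \<omega> (Suc p)"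
    if "b \<in> sections (forms (Suc p) two_forms)" for b
    using that by (simp only: zeroC_eq linear_0[OF linear_contract])
  moreover have "sections (forms (Suc p) two_forms :: ('v list \<Rightarrow> 'v \<Rightarrow> 'v \<Rightarrow> real) set) \<noteq> ({} :: ('v \<Rightarrow> _) set)"
    using subspace_0[OF subspace_sections[OF subspace_forms[OF subspace_two_forms]]] by blast
  ultimately show ?thesis
    unfolding image_del_bar[OF \<omega>] by (metis (no_types, lifting) image_cong image_constant_conv)
qed

text \<open>
  The chase common to all cokernels. If \<open>\<partial>b\<close> is up to sign \<open>\<phi> a\<close> with \<open>a\<close> a Koszul cycle, then
  \<open>a = \<iota>\<^sub>q a'\<close>, so \<open>b - \<phi> a'\<close> is a Koszul cycle and hence a boundary. Modulo the image of \<open>\<phi>\<close> this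
  writes \<open>b\<close> as a boundary.
\<close>
lemma koszul_pair_chase:
  fixes \<omega> :: "'v::euclidean_space \<Rightarrow> 'v \<Rightarrow> real"
  assumes \<omega>: "\<omega> \<in> two_forms"
    and b: "b \<in> sections (forms (Suc (Suc m)) two_forms)"
    and a: "a \<in> sections (forms (Suc (Suc m)) UNIV)"
    and ab: "\<And>q. phi \<omega> (Suc (Suc m)) (a q) = contract q (b q)"
    and closed: "\<And>q. contract q (a q) = 0"
  shows "coset_section (im_phi \<omega> (Suc (Suc (Suc m)))) b \<in> del_bar \<omega> (Suc (Suc (Suc m))) ` \<Gamma>C \<omega> (Suc (Suc (Suc (Suc m))))"
proof -
  let ?i = "Suc (Suc (Suc m))"
  obtain a' where a': "a' \<in> sections (forms ?i UNIV)" "\<And>q. contract q (a' q) = a q"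
    by (rule koszul_exact[OF subspace_UNIV finite_Basis _ a closed]) auto
  have \<phi>a': "(\<lambda>q. phi \<omega> ?i (a' q)) \<in> sections (forms (Suc (Suc m)) two_forms)"
    by (rule sections_linear_image[OF a'(1) linear_phi[OF \<omega>] phi_in_forms[OF \<omega>]])
  define c where "c = (\<lambda>q. b q + - phi \<omega> ?i (a' q))"
  have c: "c \<in> sections (forms (Suc (Suc m)) two_forms)"
    unfolding c_def
    by (intro sections_add sections_neg subspace_forms subspace_two_forms b \<phi>a')
  have "contract q (c q) = 0" for q
    using phi_contract[OF \<omega> sections_mem[OF a'(1)], of q q]
    by (simp add: c_def linear_diff[OF linear_contract] a'(2) ab)
  moreover obtain T where "finite T" "(two_forms :: ('v \<Rightarrow> 'v \<Rightarrow> real) set) \<subseteq> span T"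
    using two_forms_finite_span by blast
  ultimately obtain b' where b': "b' \<in> sections (forms ?i two_forms)" "\<And>q. contract q (b' q) = c q"
    using koszul_exact[OF subspace_two_forms _ _ c] by blast
  have "coset_section (im_phi \<omega> ?i) b = coset_section (im_phi \<omega> ?i) (\<lambda>q. contract q (b' q))"
    unfolding coset_section_eq_iff[OF subspace_im_phi[OF \<omega>]] b'(2)
    using sections_mem[OF a'(1)] by (auto simp: c_def im_phi_def)
  then show ?thesis
    unfolding image_del_bar[OF \<omega>] using b'(1) by blast
qed

text \<open>
  Here the indices are such that \<open>a\<close> with \<open>\<phi> a = \<iota>\<^sub>q b\<close> is automatically a cycle: \<open>\<iota>\<^sub>q a\<close> is
  killed by \<open>\<phi>\<^sup>\<omega>_(m+2)\<close>, which is injective since its index is at least \<open>2\<close>.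
\<close>
lemma exact_at_cokernel:
  assumes \<omega>: "symplectic_form \<omega>"
  shows "del_bar \<omega> (Suc (Suc (Suc (Suc m)))) ` \<Gamma>C \<omega> (Suc (Suc (Suc (Suc (Suc m))))) =
    {F \<in> \<Gamma>C \<omega> (Suc (Suc (Suc (Suc m)))). del_bar \<omega> (Suc (Suc (Suc m))) F = zeroC \<omega> (Suc (Suc (Suc m)))}"
    (is "?L = ?K")
proof (intro equalityI subsetI)
  note \<omega>2 = symplectic_two_form[OF \<omega>]
  let ?i = "Suc (Suc (Suc m))"
  fix F assume F: "F \<in> ?L"
  then have "F \<in> \<Gamma>C \<omega> (Suc ?i)"
    using additive_del_bar[OF \<omega>2] by (auto simp: additive_map_def)
  moreover obtain b where b: "b \<in> sections (forms (Suc ?i) two_forms)"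
    "F = coset_section (im_phi \<omega> (Suc ?i)) (\<lambda>q. contract q (b q))"
    using F unfolding image_del_bar[OF \<omega>2] by auto
  moreover have "contract q (contract q (b q)) = 0" for q
    by (rule contract_self[OF sections_mem[OF b(1)]])
  ultimately show "F \<in> ?K"
    by (simp add: del_bar_coset_section[OF \<omega>2 sections_contract[OF subspace_two_forms b(1)]] zeroC_eq)
next
  note \<omega>2 = symplectic_two_form[OF \<omega>]
  let ?i = "Suc (Suc (Suc m))"
  fix F assume "F \<in> ?K"
  then obtain b where b: "b \<in> sections (forms ?i two_forms)" "F = coset_section (im_phi \<omega> (Suc ?i)) b"
    and 0: "del_bar \<omega> ?i F = zeroC \<omega> ?i"
    by (auto simp: \<Gamma>C_eq[OF \<omega>2])
  have im: "contract q (b q) \<in> im_phi \<omega> ?i" for q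
    using 0 subspace_neg[OF subspace_im_phi[OF \<omega>2], of "- contract q (b q)"]
    by (simp add: b(2) del_bar_coset_section[OF \<omega>2 b(1)] zeroC_eq coset_section_eq_iff[OF subspace_im_phi[OF \<omega>2]])
  obtain a where a: "a \<in> sections (forms ?i UNIV)" "\<And>q. phi \<omega> ?i (a q) = contract q (b q)"
    by (rule lift_section_through_phi[OF \<omega> sections_contract[OF subspace_two_forms b(1)] im]) blast
  have "contract q (a q) = 0" for q
  proof (rule phi_injective[OF \<omega>])
    show "contract q (a q) \<in> forms (Suc (Suc m)) UNIV"
      by (rule contract_in_forms[OF sections_mem[OF a(1)]])
    show "phi \<omega> (Suc (Suc m)) (contract q (a q)) = 0"
      by (simp add: phi_contract[OF \<omega>2 sections_mem[OF a(1)]] a(2) contract_self[OF sections_mem[OF b(1)]])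
  qed
  then show "F \<in> ?L"
    unfolding b(2) by (rule koszul_pair_chase[OF \<omega>2 b(1) a])
qed

section \<open>The connecting map and the foliation\<close>

lemma phi2_inv_eq:
  assumes \<omega>: "symplectic_form \<omega>" and \<eta>: "\<eta> \<in> forms 2 UNIV"
  shows "phi2_inv \<omega> (phi \<omega> 2 \<eta>) = \<eta>"
proof -
  have "inj_on (phi \<omega> 2) (forms 2 UNIV)"
    unfolding linear_inj_on_iff_eq_0[OF linear_phi[OF symplectic_two_form[OF \<omega>]] subspace_forms[OF subspace_UNIV]]
    using phi_injective[OF \<omega>, of _ 0] by (simp add: numeral_2_eq_2)
  then show ?thesis
    using \<eta> by (simp add: phi2_inv_def)
qed

text \<open>
  Changing \<open>b\<close> by \<open>\<phi>\<^sup>\<omega>_3 m\<close> changes \<open>a\<close> by \<open>\<iota>\<^sub>q m\<close>, which a second contraction with \<open>q\<close> kills; hence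
  the value does not depend on the representative.
\<close>
lemma connecting_coset_section:
  assumes \<omega>: "symplectic_form \<omega>" and b: "b \<in> sections (forms 2 two_forms)"
    and a: "\<And>q. a q \<in> forms 2 UNIV" and ab: "\<And>q. phi \<omega> 2 (a q) = contract q (b q)"
  shows "connecting \<omega> (coset_section (im_phi \<omega> 3) b) = (\<lambda>q x. - contract q (a q) [x])"
proof
  fix q
  note \<omega>2 = symplectic_two_form[OF \<omega>]
  let ?h = "\<lambda>\<eta> x. d q (phi2_inv \<omega> (del q \<eta>)) [x]"
  have h: "?h (b q + v) = (\<lambda>x. - contract q (a q) [x])" if v: "v \<in> im_phi \<omega> 3" for v
  proof -
    obtain m where m: "m \<in> forms 3 UNIV" "v = phi \<omega> 3 m"
      using v by (auto simp: im_phi_def)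
    have cm: "contract q m \<in> forms 2 UNIV"
      using m contract_in_forms by (simp add: numeral_2_eq_2 numeral_3_eq_3)
    have "phi \<omega> 3 m \<in> forms 2 two_forms"
      using phi_in_forms[OF \<omega>2, of m 2] m by (simp add: numeral_2_eq_2 numeral_3_eq_3)
    then have "b q + v \<in> forms 2 two_forms"
      using m sections_mem[OF b] by (auto intro: subspace_add subspace_forms subspace_two_forms)
    from del_eq_contract[OF this]
    have "del q (b q + v) = - contract q (b q) - contract q v"
      by (simp only: linear_add[OF linear_contract] minus_add_distrib diff_conv_add_uminus)
    also have "contract q v = phi \<omega> 2 (contract q m)"
      using phi_contract[OF \<omega>2, of m 1 q] m by (simp add: numeral_2_eq_2 numeral_3_eq_3)
    finally have "del q (b q + v) = phi \<omega> 2 (- a q - contract q m)"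
      by (simp only: linear_diff[OF linear_phi[OF \<omega>2]] linear_neg[OF linear_phi[OF \<omega>2]] ab)
    moreover have mem: "- a q - contract q m \<in> forms 2 UNIV"
      using a cm by (intro subspace_diff subspace_neg subspace_forms subspace_UNIV)
    ultimately have "d q (phi2_inv \<omega> (del q (b q + v))) = contract q (- a q - contract q m)"
      by (simp add: phi2_inv_eq[OF \<omega>] d_eq_contract[OF mem])
    also have "\<dots> = - contract q (a q)"
      by (simp add: linear_diff[OF linear_contract] linear_neg[OF linear_contract] contract_self[OF m(1)])
    finally show ?thesis by simp
  qed
  have "the_elem (?h ` (b q +o im_phi \<omega> 3)) = ?h (b q)"
    using h h[of 0] subspace_0[OF subspace_im_phi[OF \<omega>2]]
    by (intro the_elem_coset subspace_im_phi[OF \<omega>2]) simp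
  then show "connecting \<omega> (coset_section (im_phi \<omega> 3) b) q = (\<lambda>x. - contract q (a q) [x])"
    using h[of 0] subspace_0[OF subspace_im_phi[OF \<omega>2]] by (simp add: connecting_def coset_section_def)
qed

text \<open>
  The bijectivity of \<open>\<phi>\<^sup>\<omega>_2\<close> makes \<open>a\<close> exist for every section of \<open>C\<^sub>3\<close>, without a cycle condition.
\<close>
lemma \<Gamma>C_3_cases:
  assumes \<omega>: "symplectic_form \<omega>" and "F \<in> \<Gamma>C \<omega> 3"
  obtains b a where "b \<in> sections (forms 2 two_forms)" "a \<in> sections (forms 2 UNIV)"
    "F = coset_section (im_phi \<omega> 3) b" "\<And>q. phi \<omega> 2 (a q) = contract q (b q)"
    "connecting \<omega> F = (\<lambda>q x. - contract q (a q) [x])"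
proof -
  obtain b where b: "b \<in> sections (forms 2 two_forms)" "F = coset_section (im_phi \<omega> 3) b"
    using assms(2) \<Gamma>C_eq[OF symplectic_two_form[OF \<omega>], of 2] by (auto simp: numeral_3_eq_3 numeral_2_eq_2)
  have sec: "(\<lambda>q. contract q (b q)) \<in> sections (forms (Suc 0) two_forms)"
    using sections_contract[OF subspace_two_forms, of b "Suc 0"] b(1) by (simp add: numeral_2_eq_2)
  have im: "contract q (b q) \<in> im_phi \<omega> (Suc (Suc 0))" for q
  proof -
    obtain \<eta> where "\<eta> \<in> forms 2 UNIV" "phi \<omega> 2 \<eta> = contract q (b q)"
      using phi2_surjective[OF \<omega> sections_mem[OF sec, of q]] by auto
    then show ?thesis
      unfolding im_phi_def numeral_2_eq_2 by (intro image_eqI[of _ _ \<eta>]) simp_all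
  qed
  obtain a where a: "a \<in> sections (forms 2 UNIV)" "\<And>q. phi \<omega> 2 (a q) = contract q (b q)"
    using lift_section_through_phi[OF \<omega> sec im] by (auto simp: numeral_2_eq_2)
  show ?thesis
    using that[OF b(1) a(1) b(2) a(2)] connecting_coset_section[OF \<omega> b(1) sections_mem[OF a(1)] a(2)] b(2)
    by simp
qed

lemma subspace_sp:
  assumes "\<omega> \<in> two_forms" shows "subspace (sp \<omega>)"
proof -
  note l = linear_add[OF two_forms_linear(1)[OF assms]] linear_add[OF two_forms_linear(2)[OF assms]]
    linear_cmul[OF two_forms_linear(1)[OF assms]] linear_cmul[OF two_forms_linear(2)[OF assms]]
    linear_0[OF two_forms_linear(1)[OF assms]] linear_0[OF two_forms_linear(2)[OF assms]]
  show ?thesis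
    unfolding subspace_def
  proof (intro conjI ballI allI)
    show "0 \<in> sp \<omega>" by (simp add: sp_def zero_fun_def linear_zero l)
    fix A B and c :: real assume A: "A \<in> sp \<omega>"
    have "\<omega> (c *\<^sub>R A x) y + \<omega> x (c *\<^sub>R A y) = c * (\<omega> (A x) y + \<omega> x (A y))" for x y
      by (simp add: l distrib_left)
    then show "c *\<^sub>R A \<in> sp \<omega>"
      using A by (simp add: sp_def scaleR_fun_def linear_compose_scale_right)
    assume B: "B \<in> sp \<omega>"
    have "\<omega> (A x + B x) y + \<omega> x (A y + B y) =
        (\<omega> (A x) y + \<omega> x (A y)) + (\<omega> (B x) y + \<omega> x (B y))" for x y
      by (simp add: l)
    then show "A + B \<in> sp \<omega>"
      using A B by (simp add: sp_def plus_fun_def linear_compose_add)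
  qed
qed

text \<open>
  \<open>\<phi>\<^sup>\<omega>_1(\<iota>\<^sub>q a) = \<iota>\<^sub>q(\<phi>\<^sup>\<omega>_2 a) = \<iota>\<^sub>q \<iota>\<^sub>q b = 0\<close>, and the kernel of \<open>\<phi>\<^sup>\<omega>_1\<close> is the symplectic Lie algebra.
\<close>
lemma connecting_in_sp:
  assumes \<omega>: "\<omega> \<in> two_forms" and b: "b \<in> sections (forms 2 two_forms)"
    and a: "a \<in> sections (forms 2 UNIV)" and ab: "\<And>q. phi \<omega> 2 (a q) = contract q (b q)"
  shows "(\<lambda>q x. - contract q (a q) [x]) \<in> sections (sp \<omega>)"
proof -
  have sec: "(\<lambda>q. contract q (a q)) \<in> sections (forms (Suc 0) UNIV)"
    using sections_contract[OF subspace_UNIV, of a "Suc 0"] a by (simp add: numeral_2_eq_2)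
  have "phi \<omega> (Suc 0) (contract q (a q)) = 0" for q
    using phi_contract[OF \<omega>, of "a q" 0 q] sections_mem[OF a, of q] contract_self[OF sections_mem[OF b]]
    by (simp add: ab[unfolded numeral_2_eq_2] numeral_2_eq_2)
  then have "(\<lambda>q. contract q (a q)) \<in> sections {\<eta> \<in> forms (Suc 0) UNIV. phi \<omega> (Suc 0) \<eta> = 0}"
    using sec by (simp add: sections_def)
  moreover have "linear (\<lambda>\<eta> x. - \<eta> [x] :: 'a)"
    by (rule linearI) (auto simp: fun_eq_iff)
  moreover have "(\<lambda>x. - \<eta> [x]) \<in> sp \<omega>" if "\<eta> \<in> forms (Suc 0) UNIV" "phi \<omega> (Suc 0) \<eta> = 0" for \<eta>
    using subspace_neg[OF subspace_sp[OF \<omega>], of "\<lambda>x. \<eta> [x]"] phi1_eq_0_iff[OF \<omega> that(1)] that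
    by (simp add: fun_Compl_def)
  ultimately show ?thesis
    using sections_linear_image[of "\<lambda>q. contract q (a q)" _ "\<lambda>\<eta> x. - \<eta> [x]" "sp \<omega>"] by blast
qed

lemma additive_connecting:
  assumes \<omega>: "symplectic_form \<omega>"
  shows "additive_map (\<Gamma>C \<omega> 3) (connecting \<omega>) (sections (sp \<omega>))"
  unfolding additive_map_def
proof (intro conjI subsetI ballI)
  note \<omega>2 = symplectic_two_form[OF \<omega>]
  show "A \<in> sections (sp \<omega>)" if "A \<in> connecting \<omega> ` \<Gamma>C \<omega> 3" for A
  proof -
    obtain F where "F \<in> \<Gamma>C \<omega> 3" "A = connecting \<omega> F"
      using \<open>A \<in> connecting \<omega> ` \<Gamma>C \<omega> 3\<close> by auto
    then show ?thesis
      by (elim \<Gamma>C_3_cases[OF \<omega>]) (simp add: connecting_in_sp[OF \<omega>2])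
  qed
  fix F G assume "F \<in> \<Gamma>C \<omega> 3" "G \<in> \<Gamma>C \<omega> 3"
  obtain b a where F: "b \<in> sections (forms 2 two_forms)" "a \<in> sections (forms 2 UNIV)"
    "F = coset_section (im_phi \<omega> 3) b" "\<And>q. phi \<omega> 2 (a q) = contract q (b q)"
    "connecting \<omega> F = (\<lambda>q x. - contract q (a q) [x])"
    by (rule \<Gamma>C_3_cases[OF \<omega> \<open>F \<in> \<Gamma>C \<omega> 3\<close>]) blast
  obtain b' a' where G: "b' \<in> sections (forms 2 two_forms)" "a' \<in> sections (forms 2 UNIV)"
    "G = coset_section (im_phi \<omega> 3) b'" "\<And>q. phi \<omega> 2 (a' q) = contract q (b' q)"
    "connecting \<omega> G = (\<lambda>q x. - contract q (a' q) [x])"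
    by (rule \<Gamma>C_3_cases[OF \<omega> \<open>G \<in> \<Gamma>C \<omega> 3\<close>]) blast
  have "connecting \<omega> (F + G) = (\<lambda>q x. - contract q (a q + a' q) [x])"
    unfolding F(3) G(3) coset_section_add[OF subspace_im_phi[OF \<omega>2]]
  proof (rule connecting_coset_section[OF \<omega>])
    show "(\<lambda>q. b q + b' q) \<in> sections (forms 2 two_forms)"
      by (intro sections_add subspace_forms subspace_two_forms F G)
    show "a q + a' q \<in> forms 2 UNIV" for q
      by (intro subspace_add subspace_forms subspace_UNIV sections_mem[OF F(2)] sections_mem[OF G(2)])
    show "phi \<omega> 2 (a q + a' q) = contract q (b q + b' q)" for q
      by (simp add: linear_add[OF linear_phi[OF \<omega>2]] linear_add[OF linear_contract] F(4) G(4))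
  qed
  then show "connecting \<omega> (F + G) = connecting \<omega> F + connecting \<omega> G"
    unfolding F(5) G(5) by (simp add: linear_add[OF linear_contract] fun_eq_iff)
qed

text \<open>
  At \<open>C\<^sub>3\<close> the condition \<open>\<iota>\<^sub>q a = 0\<close> of the chase is the vanishing of the connecting map itself,
  whereas for the other cokernels it comes from the injectivity of the next \<open>\<phi>\<close>.
\<close>
lemma exact_at_\<Gamma>C_3:
  assumes \<omega>: "symplectic_form \<omega>"
  shows "del_bar \<omega> 3 ` \<Gamma>C \<omega> 4 = {F \<in> \<Gamma>C \<omega> 3. connecting \<omega> F = 0}"
proof (intro equalityI subsetI)
  note \<omega>2 = symplectic_two_form[OF \<omega>]
  have four: "(4::nat) = Suc 3" by simp
  fix F assume F: "F \<in> del_bar \<omega> 3 ` \<Gamma>C \<omega> 4"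
  then have "F \<in> \<Gamma>C \<omega> 3"
    using additive_del_bar[OF \<omega>2, of 2] by (auto simp: additive_map_def numeral_2_eq_2 numeral_3_eq_3 four)
  moreover have "\<exists>b\<in>sections (forms 3 two_forms). F = coset_section (im_phi \<omega> 3) (\<lambda>q. contract q (b q))"
    using F image_del_bar[OF \<omega>2, of 2] by (auto simp: numeral_2_eq_2 numeral_3_eq_3 four)
  then obtain b where b: "b \<in> sections (forms 3 two_forms)"
    "F = coset_section (im_phi \<omega> 3) (\<lambda>q. contract q (b q))" by blast
  have "connecting \<omega> F = (\<lambda>q x. - contract q (0 :: 'a list \<Rightarrow> 'a) [x])"
    unfolding b(2)
  proof (rule connecting_coset_section[OF \<omega>])
    show "(\<lambda>q. contract q (b q)) \<in> sections (forms 2 two_forms)"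
      using sections_contract[OF subspace_two_forms, of b 2] b(1) by (simp add: numeral_2_eq_2 numeral_3_eq_3)
    show "0 \<in> forms 2 UNIV" by (intro subspace_0 subspace_forms subspace_UNIV)
    show "phi \<omega> 2 0 = contract q (contract q (b q))" for q
      by (simp add: contract_self[OF sections_mem[OF b(1)]] linear_0[OF linear_phi[OF \<omega>2]])
  qed
  ultimately show "F \<in> {F \<in> \<Gamma>C \<omega> 3. connecting \<omega> F = 0}"
    by (simp add: contract_def fun_eq_iff)
next
  note \<omega>2 = symplectic_two_form[OF \<omega>]
  fix F assume "F \<in> {F \<in> \<Gamma>C \<omega> 3. connecting \<omega> F = 0}"
  then have "F \<in> \<Gamma>C \<omega> 3" and 0: "connecting \<omega> F = 0" by auto
  obtain b a where F: "b \<in> sections (forms 2 two_forms)" "a \<in> sections (forms 2 UNIV)"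
    "F = coset_section (im_phi \<omega> 3) b" "\<And>q. phi \<omega> 2 (a q) = contract q (b q)"
    "connecting \<omega> F = (\<lambda>q x. - contract q (a q) [x])"
    by (rule \<Gamma>C_3_cases[OF \<omega> \<open>F \<in> \<Gamma>C \<omega> 3\<close>]) blast
  have "contract q (a q) = 0" for q
  proof
    fix xs
    have mem: "contract q (a q) \<in> forms (Suc 0) UNIV"
      by (rule contract_in_forms[OF sections_mem[OF F(2), unfolded numeral_2_eq_2]])
    show "contract q (a q) xs = 0 xs"
    proof (cases "length xs = Suc 0")
      case True
      then obtain x where "xs = [x]" by (cases xs) auto
      then show ?thesis using fun_cong[OF fun_cong[OF 0[unfolded F(5)], of q], of x] by simp
    qed (use forms_memD(2)[OF mem] in simp)
  qed
  then show "F \<in> del_bar \<omega> 3 ` \<Gamma>C \<omega> 4"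
    using koszul_pair_chase[OF \<omega>2, of b 0 a] F
    by (simp add: numeral_2_eq_2 numeral_3_eq_3 eval_nat_numeral)
qed

text \<open>
  Regarded as a vector-valued \<open>1\<close>-form \<open>L A\<close>, a section \<open>A\<close> with \<open>A(q) q = 0\<close> is a Koszul cycle,
  hence \<open>\<iota>\<^sub>q a\<close> for some \<open>a\<close>. Then \<open>\<phi>\<^sup>\<omega>_2 a\<close> is a cycle as well, since \<open>\<phi>\<^sup>\<omega>_1(L A) = 0\<close>, hence
  \<open>\<iota>\<^sub>q b\<close> for some \<open>b\<close>, and the class of \<open>- b\<close> is mapped to \<open>A\<close>.
\<close>
lemma exact_at_sp:
  fixes \<omega> :: "'v::euclidean_space \<Rightarrow> 'v \<Rightarrow> real"
  assumes \<omega>: "symplectic_form \<omega>"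
  shows "connecting \<omega> ` \<Gamma>C \<omega> 3 = {A \<in> sections (sp \<omega>). rho A = 0}"
proof (intro equalityI subsetI)
  note \<omega>2 = symplectic_two_form[OF \<omega>]
  fix A assume "A \<in> connecting \<omega> ` \<Gamma>C \<omega> 3"
  then obtain F where F': "F \<in> \<Gamma>C \<omega> 3" "A = connecting \<omega> F" by auto
  obtain b a where F: "b \<in> sections (forms 2 two_forms)" "a \<in> sections (forms 2 UNIV)"
    "F = coset_section (im_phi \<omega> 3) b" "\<And>q. phi \<omega> 2 (a q) = contract q (b q)"
    "connecting \<omega> F = (\<lambda>q x. - contract q (a q) [x])"
    by (rule \<Gamma>C_3_cases[OF \<omega> F'(1)]) blast
  have "a q [q, q] = 0" for q
    using forms_memD(4)[OF sections_mem[OF F(2)]] by simp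
  then have "rho A = 0"
    by (simp add: F'(2) F(5) rho_def contract_def fun_eq_iff)
  then show "A \<in> {A \<in> sections (sp \<omega>). rho A = 0}"
    using connecting_in_sp[OF \<omega>2 F(1,2,4)] F'(2) F(5) by simp
next
  note \<omega>2 = symplectic_two_form[OF \<omega>]
  fix A assume "A \<in> {A \<in> sections (sp \<omega>). rho A = 0}"
  then have A: "A \<in> sections (sp \<omega>)" and 0: "A q q = 0" for q
    by (auto simp: rho_def fun_eq_iff)
  define L where "L = (\<lambda>(M::'v \<Rightarrow> 'v) xs. if length xs = Suc 0 then M (hd xs) else 0)"
  have L_app: "L M [x] = M x" for M x
    by (simp add: L_def)
  have linL: "linear L"
    by (rule linearI) (auto simp: L_def fun_eq_iff)
  have L_form: "L M \<in> forms (Suc 0) UNIV" if "linear M" for M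
  proof -
    have "linear (\<lambda>v. L M (xs[0 := v]))" if "length xs = Suc 0" for xs
      using that \<open>linear M\<close> by (cases xs) (auto simp: L_def)
    moreover have "distinct xs" if "length xs = Suc 0" for xs :: "'v list"
      using that by (cases xs) auto
    ultimately show ?thesis by (auto simp: forms_def L_def)
  qed
  have LA: "(\<lambda>q. L (A q)) \<in> sections (forms (Suc 0) UNIV)"
    by (rule sections_linear_image[OF A linL L_form]) (simp add: sp_def)
  have "contract q (L (A q)) = 0" for q
    using 0 by (auto simp: contract_def L_def fun_eq_iff)
  then obtain a where a: "a \<in> sections (forms 2 UNIV)" "\<And>q. contract q (a q) = L (A q)"
    using koszul_exact[OF subspace_UNIV finite_Basis _ LA] by (auto simp: numeral_2_eq_2)
  define \<tau> where "\<tau> = (\<lambda>q. phi \<omega> 2 (a q))"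
  have \<tau>: "\<tau> \<in> sections (forms (Suc 0) two_forms)"
    unfolding \<tau>_def using sections_linear_image[OF a(1) linear_phi[OF \<omega>2]] phi_in_forms[OF \<omega>2]
    by (simp add: numeral_2_eq_2)
  have "contract q (\<tau> q) = 0" for q
  proof -
    have "contract q (\<tau> q) = phi \<omega> (Suc 0) (L (A q))"
      unfolding \<tau>_def a(2)[symmetric]
      using phi_contract[OF \<omega>2, of "a q" 0 q] sections_mem[OF a(1), of q] by (simp add: numeral_2_eq_2)
    also have "\<dots> = 0"
      using phi1_eq_0_iff[OF \<omega>2 sections_mem[OF LA]] sections_mem[OF A] by (simp add: L_app)
    finally show ?thesis .
  qed
  note closed = this
  obtain T where T: "finite T" "(two_forms :: ('v \<Rightarrow> 'v \<Rightarrow> real) set) \<subseteq> span T"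
    using two_forms_finite_span by blast
  obtain b where b: "b \<in> sections (forms 2 two_forms)" "\<And>q. contract q (b q) = \<tau> q"
    unfolding numeral_2_eq_2 by (rule koszul_exact[OF subspace_two_forms T \<tau> closed]) blast
  have nb: "(\<lambda>q. - b q) \<in> sections (forms 2 two_forms)"
    by (intro sections_neg subspace_forms subspace_two_forms b)
  have "connecting \<omega> (coset_section (im_phi \<omega> 3) (\<lambda>q. - b q)) = (\<lambda>q x. - contract q (- a q) [x])"
  proof (rule connecting_coset_section[OF \<omega> nb])
    show "- a q \<in> forms 2 UNIV" for q
      by (intro subspace_neg subspace_forms subspace_UNIV sections_mem[OF a(1)])
    show "phi \<omega> 2 (- a q) = contract q (- b q)" for q
      by (simp add: linear_neg[OF linear_phi[OF \<omega>2]] linear_neg[OF linear_contract] b(2) \<tau>_def)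
  qed
  also have "\<dots> = A"
    by (simp add: linear_neg[OF linear_contract] a(2) L_app)
  finally have "A = connecting \<omega> (coset_section (im_phi \<omega> 3) (\<lambda>q. - b q))" ..
  moreover have "coset_section (im_phi \<omega> 3) (\<lambda>q. - b q) \<in> \<Gamma>C \<omega> 3"
    using \<Gamma>C_eq[OF \<omega>2, of 2] nb by (simp add: numeral_2_eq_2 numeral_3_eq_3)
  ultimately show "A \<in> connecting \<omega> ` \<Gamma>C \<omega> 3" by blast
qed

theorem proposition2p12:
  fixes \<omega> :: "'v::euclidean_space \<Rightarrow> 'v \<Rightarrow> real" and n :: nat
  assumes "symplectic_form \<omega>" and "n = DIM('v)" and "n \<ge> 2"
  shows
   "(n = 2 \<longrightarrow>
       exact_at {zeroC \<omega> 3} id (\<Gamma>C \<omega> 3) (connecting \<omega>) (sections (sp \<omega>)) 0) \<and>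
    (n > 2 \<longrightarrow>
       exact_at {zeroC \<omega> (n + 1)} id (\<Gamma>C \<omega> (n + 1)) (del_bar \<omega> n) (\<Gamma>C \<omega> n) (zeroC \<omega> n)) \<and>
    (\<forall>i\<in>{4..n}.
       exact_at (\<Gamma>C \<omega> (i + 1)) (del_bar \<omega> i) (\<Gamma>C \<omega> i) (del_bar \<omega> (i - 1))
         (\<Gamma>C \<omega> (i - 1)) (zeroC \<omega> (i - 1))) \<and>
    (n > 2 \<longrightarrow>
       exact_at (\<Gamma>C \<omega> 4) (del_bar \<omega> 3) (\<Gamma>C \<omega> 3) (connecting \<omega>) (sections (sp \<omega>)) 0) \<and>
    exact_at (\<Gamma>C \<omega> 3) (connecting \<omega>) (sections (sp \<omega>)) rho (foliation \<omega>) 0 \<and>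
    exact_at (sections (sp \<omega>)) rho (foliation \<omega>) (\<lambda>_. 0) {0 :: 'v \<Rightarrow> 'v} 0"
proof -
  note \<omega> = assms(1) and \<omega>2 = symplectic_two_form[OF assms(1)]
  \<comment> \<open>The zero section at the left end, as the image of a further cokernel map.\<close>
  have zero_image: "{zeroC \<omega> (Suc p)} = del_bar \<omega> (Suc p) ` \<Gamma>C \<omega> (Suc (Suc p))" if "n \<le> p" for p
    using image_del_bar_above_dim[OF \<omega>2] that assms(2) by simp
  have add_zero: "additive_map {zeroC \<omega> (Suc p)} id (\<Gamma>C \<omega> (Suc p))" if "n \<le> p" for p
    using additive_del_bar[OF \<omega>2, of p] zero_image[OF that] by (auto simp: additive_map_def)
  have mid: "exact_at (\<Gamma>C \<omega> (Suc i)) (del_bar \<omega> i) (\<Gamma>C \<omega> i) (del_bar \<omega> (i - 1))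
      (\<Gamma>C \<omega> (i - 1)) (zeroC \<omega> (i - 1))" if "4 \<le> i" for i
  proof -
    define m where "m = i - 4"
    have "i = Suc (Suc (Suc (Suc m)))"
      using that unfolding m_def by arith
    then show ?thesis
      using exact_at_cokernel[OF \<omega>, of m] additive_del_bar[OF \<omega>2]
      by (simp add: exact_at_def)
  qed
  have at3: "exact_at (\<Gamma>C \<omega> 4) (del_bar \<omega> 3) (\<Gamma>C \<omega> 3) (connecting \<omega>) (sections (sp \<omega>)) 0"
    using additive_del_bar[OF \<omega>2, of 2] additive_connecting[OF \<omega>] exact_at_\<Gamma>C_3[OF \<omega>]
    by (simp add: exact_at_def numeral_2_eq_2 numeral_3_eq_3 eval_nat_numeral)
  have add_rho: "additive_map (sections (sp \<omega>)) rho (foliation \<omega>)"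
    by (auto simp: additive_map_def foliation_def rho_def fun_eq_iff)
  have "exact_at {zeroC \<omega> 3} id (\<Gamma>C \<omega> 3) (connecting \<omega>) (sections (sp \<omega>)) 0" if "n = 2"
    using at3 add_zero[of 2] zero_image[of 2] that
    by (simp add: exact_at_def numeral_2_eq_2 numeral_3_eq_3 eval_nat_numeral)
  moreover have "exact_at {zeroC \<omega> (n + 1)} id (\<Gamma>C \<omega> (n + 1)) (del_bar \<omega> n) (\<Gamma>C \<omega> n) (zeroC \<omega> n)"
    if "n > 2"
    using mid[of "Suc n"] add_zero[of n] zero_image[of n] that
    by (simp add: exact_at_def)
  moreover have "exact_at (\<Gamma>C \<omega> 3) (connecting \<omega>) (sections (sp \<omega>)) rho (foliation \<omega>) 0"
    using additive_connecting[OF \<omega>] add_rho exact_at_sp[OF \<omega>] by (simp add: exact_at_def)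
  moreover have "exact_at (sections (sp \<omega>)) rho (foliation \<omega>) (\<lambda>_. 0) {0 :: 'v \<Rightarrow> 'v} 0"
    using add_rho by (auto simp: exact_at_def additive_map_def foliation_def)
  ultimately show ?thesis
    using mid at3 by auto
qed

end
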